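(* Let $m,n\ge1$ and let the Poisson--Lie structures on $FDiff(\mathbb R^m)$ and $FDiff(\mathbb R^n)$ be given by $$\Omega_m^{\sigma\rho}\left(j^{\infty}_{u}X,j^{\infty}_{v}X\right)=\left(X_{*u}\right)^{\sigma}_{\mu}\left(X_{*v}\right)^{\rho}_{\nu}\varphi_m^{\mu\nu}(u,v)-\varphi_m^{\sigma\rho}\left(X(u),X(v)\right)$$ and $$\Omega_n^{ij}\left(j^{\infty}_{a}Y,j^{\infty}_{b}Y\right)=\left(Y_{*a}\right)^{i}_{k}\left(Y_{*b}\right)^{j}_{l}\varphi_n^{kl}(a,b)-\varphi_n^{ij}\left(Y(a),Y(b)\right),$$ respectively, where $u,v\in\mathbb R^m$, $a,b\in\mathbb R^n$, and $\varphi_m^{\mu\nu}(u,v)$, $\varphi_n^{kl}(a,b)$ are the corresponding $r$-matrices. Consider the following functional equations for an unknown $\Pi^{ij}(j^\infty_uF,j^\infty_vF)$, required for all $X\in FDiff(\mathbb R^m)$, $Y\in FDiff(\mathbb R^n)$, $F\in J^\infty(\mathbb R^m,\mathbb R^n)$, with $\overline F=Y\circ F\circ X^{-1}$: $$\begin{aligned}\Pi^{ij}\left(j^{\infty}_{u}\overline{F},j^{\infty}_{v}\overline{F}\right)=&\left(Y_{*F\circ X^{-1}(u)}\right)^i_k\left(Y_{*F\circ X^{-1}(v)}\right)^j_l\Pi^{kl}\left(j^{\infty}_{X^{-1}(u)}F,j^{\infty}_{X^{-1}(v)}F\right)\\&+\left(Y_{*F\circ X^{-1}(u)}\right)^i_k\left(F_{*X^{-1}(u)}\right)^k_{\sigma}\left(Y_{*F\circ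 X^{-1}(v)}\right)^j_l\left(F_{*X^{-1}(v)}\right)^l_{\rho}\,\Omega_m^{\sigma\rho}\left(j^{\infty}_{u}X^{-1},j^{\infty}_{v}X^{-1}\right)\\&+\Omega_n^{ij}\left(j^{\infty}_{F\circ X^{-1}(u)}Y,j^{\infty}_{F\circ X^{-1}(v)}Y\right).\end{aligned}$$ These equations have a solution of the form $$\Pi^{ij}\left(j^{\infty}_{u}F,j^{\infty}_{v}F\right)=\left(F_{*u}\right)^{i}_{\mu}\left(F_{*v}\right)^{j}_{\nu}\varphi_m^{\mu\nu}(u,v)-\varphi_n^{ij}\left(F(u),F(v)\right).$$
   Context: Greek indices run over $\{1,\dots,m\}$, Latin indices over $\{1,\dots,n\}$, and summation over repeated indices is understood. $FDiff(\mathbb R^n)$ is the formal group of formal diffeomorphisms of $\mathbb R^n$: $n$-tuples of formal power series $Y^i(a)=\sum_{\mathbf k\in\mathbb Z_+^n}y^i_{\mathbf k}\,a^{\mathbf k}$ (constant terms allowed) with invertible linear part, multiplied by composition; similarly for $FDiff(\mathbb R^m)$. $J^\infty(\mathbb R^m,\mathbb R^n)$ is the space of infinite jets of smooth maps $\mathbb R^m\to\mathbb R^n$, with elements written $F^i(u)=\sum_{\mathbf k\in\mathbb Z_+^m}f^i_{\mathbf k}u^{\mathbf k}$, $i=1,\dots,n$. The left-right action of $FDiff(\mathbb R^n)\times FDiff(\mathbb R^m)$ is $F\mapsto Y\circ F\circ X^{-1}$. All identities are understood formally, as identities of power series in $u,v$ whose coefficients are formal functions of the coordinates $x,y,f$ (with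 the determinants of the linear parts of $X$ and $Y$ invertible). $F_{*u}$, $X_{*u}$, $Y_{*a}$ denote Jacobian matrices at the indicated point (upper index = row, lower index = column), and $j^\infty_u$ the infinite jet at $u$. The $r$-matrices are families of formal power series $\varphi_m^{\mu\nu}(u,v)\in\mathbb R[[u,v]]$ and $\varphi_n^{kl}(a,b)\in\mathbb R[[a,b]]$ with $\varphi_m^{\mu\nu}(u,v)=-\varphi_m^{\nu\mu}(v,u)$ and $\varphi_n^{kl}(a,b)=-\varphi_n^{lk}(b,a)$, such that $\Omega_m$ and $\Omega_n$ are Poisson--Lie structures, i.e. the brackets $\{X^\sigma(u),X^\rho(v)\}=\Omega_m^{\sigma\rho}$ and $\{Y^i(a),Y^j(b)\}=\Omega_n^{ij}$ satisfy the Jacobi identity and make group multiplication a Poisson map. *)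

theory Defs
  imports "HOL-Analysis.Analysis" "HOL-Algebra.Group" "HOL-Library.Multiset"
    "HOL-Library.Groups_Big_Fun"
begin

section \<open>Formal power series in several variables\<close>

text \<open>
  Real formal power series in a (possibly infinite) family of variables \<open>'v\<close>.  A finite multiset
  over \<open>'v\<close> is a monomial; for a finite type \<open>'m\<close> with \<open>m\<close> elements the multisets over \<open>'m\<close> are
  exactly the multi-indices in \<open>\<int>\<^sub>+\<^sup>m\<close>.
\<close>

typedef 'v mfps = "UNIV :: ('v multiset \<Rightarrow> real) set"
  morphisms mcoeff Mfps
  by simp

lemma mcoeff_Mfps [simp]: "mcoeff (Mfps f) = f"
  by (simp add: Mfps_inverse)

lemma mfps_eqI: "(\<And>N. mcoeff f N = mcoeff g N) \<Longrightarrow> f = g"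
  by (simp add: mcoeff_inject [symmetric] fun_eq_iff)

lemma finite_submultisets: "finite {A. A \<subseteq># (N :: 'v multiset)}"
proof (induction N)
  case empty
  then show ?case by simp
next
  case (add x N)
  have "{A. A \<subseteq># add_mset x N} \<subseteq> {A. A \<subseteq># N} \<union> add_mset x ` {A. A \<subseteq># N}"
  proof
    fix A assume "A \<in> {A. A \<subseteq># add_mset x N}"
    then have A: "A \<subseteq># add_mset x N" by simp
    show "A \<in> {A. A \<subseteq># N} \<union> add_mset x ` {A. A \<subseteq># N}"
    proof (cases "x \<in># A")
      case True
      then obtain B where "A = add_mset x B" by (meson multi_member_split)
      with A show ?thesis by auto
    next
      case False
      with A have "A \<subseteq># N"
        by (metis diff_single_trivial subset_eq_diff_conv add_mset_add_single)
      then show ?thesis by simp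
    qed
  qed
  then show ?case by (rule finite_subset) (use add in auto)
qed

lemma finite_mset_splits: "finite {(A, B). A + B = (N :: 'v multiset)}"
proof (rule finite_subset)
  show "{(A, B). A + B = N} \<subseteq> {A. A \<subseteq># N} \<times> {A. A \<subseteq># N}" by auto
qed (simp add: finite_submultisets)

instantiation mfps :: (type) comm_ring_1
begin

definition "0 = Mfps (\<lambda>_. 0)"
definition "1 = Mfps (\<lambda>N. if N = {#} then 1 else 0)"
definition "f + g = Mfps (\<lambda>N. mcoeff f N + mcoeff g N)"
definition "- f = Mfps (\<lambda>N. - mcoeff f N)"
definition "f - g = Mfps (\<lambda>N. mcoeff f N - mcoeff g N)"
definition "f * g = Mfps (\<lambda>N. \<Sum>(A, B) | A + B = N. mcoeff f A * mcoeff g B)"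

instance
proof
  fix f g h :: "'a mfps"
  show "f + g + h = f + (g + h)" "f + g = g + f" "0 + f = f" "- f + f = 0" "f - g = f + - g"
    "(0 :: 'a mfps) \<noteq> 1"
    by (auto simp: plus_mfps_def zero_mfps_def one_mfps_def uminus_mfps_def minus_mfps_def
        Mfps_inject fun_eq_iff mcoeff_inverse intro!: mfps_eqI)
  show "f * g = g * f"
  proof (rule mfps_eqI)
    fix N
    have "(\<Sum>(A, B) | A + B = N. mcoeff f A * mcoeff g B)
        = (\<Sum>(A, B) | A + B = N. mcoeff g A * mcoeff f B)"
      by (rule sum.reindex_bij_witness [where i = prod.swap and j = prod.swap])
         (auto simp: add.commute)
    then show "mcoeff (f * g) N = mcoeff (g * f) N"
      by (simp add: times_mfps_def)
  qed
  show "1 * f = f"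
  proof (rule mfps_eqI)
    fix N
    have "(\<Sum>(A, B) | A + B = N. (if A = {#} then 1 else 0) * mcoeff f B)
        = (\<Sum>(A, B) \<in> {({#} :: 'a multiset, N)}. (if A = {#} then 1 else 0) * mcoeff f B)"
      by (rule sum.mono_neutral_right) (auto simp: finite_mset_splits split: if_splits)
    then show "mcoeff (1 * f) N = mcoeff f N"
      by (simp add: times_mfps_def one_mfps_def)
  qed
  show "(f + g) * h = f * h + g * h"
    by (rule mfps_eqI)
       (simp add: times_mfps_def plus_mfps_def sum.distrib [symmetric] case_prod_beta algebra_simps)
  show "f * g * h = f * (g * h)"
  proof (rule mfps_eqI)
    fix N
    let ?S = "\<lambda>N :: 'a multiset. {(A, B). A + B = N}"
    have fin: "finite (?S M)" for M :: "'a multiset"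
      by (rule finite_mset_splits)
    have "mcoeff (f * g * h) N
        = (\<Sum>p\<in>?S N. \<Sum>q\<in>?S (fst p). mcoeff f (fst q) * mcoeff g (snd q) * mcoeff h (snd p))"
      by (simp add: times_mfps_def case_prod_beta sum_distrib_right)
    also have "\<dots> = (\<Sum>(p, q)\<in>Sigma (?S N) (\<lambda>p. ?S (fst p)).
        mcoeff f (fst q) * mcoeff g (snd q) * mcoeff h (snd p))"
      by (rule sum.Sigma) (auto simp: fin)
    also have "\<dots> = (\<Sum>(p, q)\<in>Sigma (?S N) (\<lambda>p. ?S (snd p)).
        mcoeff f (fst p) * mcoeff g (fst q) * mcoeff h (snd q))"
      by (rule sum.reindex_bij_witness
          [where i = "\<lambda>((a, b), (c, d)). ((a + c, d), (a, c))"
             and j = "\<lambda>((a, b), (c, d)). ((c, d + b), (d, b))"])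
         (auto simp: add.assoc)
    also have "\<dots> = (\<Sum>p\<in>?S N. \<Sum>q\<in>?S (snd p).
        mcoeff f (fst p) * mcoeff g (fst q) * mcoeff h (snd q))"
      by (rule sum.Sigma [symmetric]) (auto simp: fin)
    also have "\<dots> = mcoeff (f * (g * h)) N"
      by (simp add: times_mfps_def case_prod_beta sum_distrib_left mult.assoc)
    finally show "mcoeff (f * g * h) N = mcoeff (f * (g * h)) N" .
  qed
qed

end

definition mvar :: "'v \<Rightarrow> 'v mfps" where
  "mvar x = Mfps (\<lambda>N. if N = {#x#} then 1 else 0)"

definition mderiv :: "'v \<Rightarrow> 'v mfps \<Rightarrow> 'v mfps" where
  "mderiv x f = Mfps (\<lambda>N. real (count N x + 1) * mcoeff f (add_mset x N))"

definition mderivs :: "'v multiset \<Rightarrow> 'v mfps \<Rightarrow> 'v mfps" where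
  "mderivs K f = fold_mset mderiv f K"

text \<open>
  Formal (coefficientwise) sums and substitution.  \<^const>\<open>Sum_any\<close> sums the nonzero terms; these
  are finite in number wherever the constructions are used below.
\<close>

definition msum :: "('i \<Rightarrow> 'v mfps) \<Rightarrow> 'v mfps" where
  "msum f = Mfps (\<lambda>N. Sum_any (\<lambda>i. mcoeff (f i) N))"

definition msubst :: "('v \<Rightarrow> 'w mfps) \<Rightarrow> 'v mfps \<Rightarrow> 'w mfps" where
  "msubst s f = Mfps (\<lambda>N. Sum_any (\<lambda>M. mcoeff f M * mcoeff (\<Prod>x\<in>#M. s x) N))"


section \<open>Formal diffeomorphisms and jets\<close>

text \<open>
  Formal functions of coordinates are elements of \<open>A = \<real>[[t\<^sub>p : p \<in> 'p]]\<close>, i.e. of \<open>'p mfps\<close>, for an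
  arbitrary set of formal parameters \<open>'p\<close>.  A formal diffeomorphism (or a jet of maps) is given by
  power series in the variables \<open>u\<close> with coefficients in \<open>A\<close>; identifying \<open>A[[u]]\<close> with
  \<open>\<real>[[t, u]]\<close>, such a series has the type \<open>('p + 'm) mfps\<close>, where \<open>Inl\<close> marks parameters
  and \<open>Inr\<close> marks the space variables.

  As compositions are formal in the constant terms of the series, these terms are elements of
  the maximal ideal of \<open>A\<close> (nonzero in general); all other coefficients are arbitrary elements of
  \<open>A\<close>, subject only to the invertibility of the linear part.  If \<open>'p\<close> is the set of all
  coordinates, this includes the tautological family in which every coordinate is an
  independent variable (expanded about a point with invertible linear part).
\<close>

definition space_coeff :: "'m multiset \<Rightarrow> ('p + 'm) mfps \<Rightarrow> 'p mfps" where
  "space_coeff K f = Mfps (\<lambda>M. mcoeff f (image_mset Inl M + image_mset Inr K))"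

text \<open>The value \<open>G(q)\<close> at a point \<open>q\<close>; the parameters are left untouched.\<close>

definition value_at :: "('p + 's) mfps \<Rightarrow> ('s \<Rightarrow> ('p + 'w) mfps) \<Rightarrow> ('p + 'w) mfps" where
  "value_at g q = msubst (case_sum (\<lambda>p. mvar (Inl p)) q) g"

definition compose ::
  "('t \<Rightarrow> ('p + 's) mfps) \<Rightarrow> ('s \<Rightarrow> ('p + 'w) mfps) \<Rightarrow> 't \<Rightarrow> ('p + 'w) mfps" where
  "compose G H = (\<lambda>i. value_at (G i) H)"

definition linear_part :: "('m::finite \<Rightarrow> ('p + 'm) mfps) \<Rightarrow> 'p mfps ^ 'm ^ 'm" where
  "linear_part X = (\<chi> \<mu> \<nu>. space_coeff {#\<nu>#} (X \<mu>))"

definition map_jets :: "('n \<Rightarrow> ('p + 'm) mfps) set" where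
  "map_jets = {F. \<forall>i. mcoeff (F i) {#} = 0}"

definition FDiff :: "('m::finite \<Rightarrow> ('p + 'm) mfps) monoid" where
  "FDiff = \<lparr> carrier = {X. X \<in> map_jets \<and> invertible (linear_part X)},
             mult = compose,
             one = (\<lambda>\<mu>. mvar (Inr \<mu>)) \<rparr>"

text \<open>
  The infinite jet \<open>j\<^sup>\<infinity>\<^sub>q G\<close> of \<open>G\<close> at a point \<open>q\<close>: the point \<open>q\<close> and the values
  at \<open>q\<close> of all partial derivatives of \<open>G\<close>, indexed by multi-indices.
\<close>

record ('s, 't, 'r) jet =
  source :: "'s \<Rightarrow> 'r"
  derivs :: "'s multiset \<Rightarrow> 't \<Rightarrow> 'r"

definition jet_at ::
  "('s \<Rightarrow> ('p + 'w) mfps) \<Rightarrow> ('t \<Rightarrow> ('p + 's) mfps) \<Rightarrow> ('s, 't, ('p + 'w) mfps) jet" where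
  "jet_at q G = \<lparr> source = q,
                  derivs = (\<lambda>K i. value_at (mderivs (image_mset Inr K) (G i)) q) \<rparr>"

definition target :: "('s, 't, 'r) jet \<Rightarrow> 't \<Rightarrow> 'r" where
  "target J i = derivs J {#} i"

definition jet_jacobian :: "('s, 't, 'r) jet \<Rightarrow> 't \<Rightarrow> 's \<Rightarrow> 'r" where
  "jet_jacobian J i \<mu> = derivs J {#\<mu>#} i"

text \<open>The two generic points \<open>u\<close> and \<open>v\<close>: identities hold in \<open>A[[u, v]]\<close>.\<close>

definition pt_u :: "'m \<Rightarrow> ('p + ('m + 'm)) mfps" where
  "pt_u \<mu> = mvar (Inr (Inl \<mu>))"

definition pt_v :: "'m \<Rightarrow> ('p + ('m + 'm)) mfps" where
  "pt_v \<mu> = mvar (Inr (Inr \<mu>))"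


section \<open>Poisson--Lie structures and r-matrices\<close>

text \<open>\<open>\<phi> \<mu> \<nu>\<close> is the series \<open>\<phi>\<^sup>\<mu>\<^sup>\<nu>(u, v) \<in> \<real>[[u, v]]\<close>, with \<open>Inl\<close> marking \<open>u\<close> and \<open>Inr\<close> marking \<open>v\<close>.\<close>

type_synonym 'm two_point = "'m \<Rightarrow> 'm \<Rightarrow> ('m + 'm) mfps"

definition value2 :: "('m + 'm) mfps \<Rightarrow> ('m \<Rightarrow> 'v mfps) \<Rightarrow> ('m \<Rightarrow> 'v mfps) \<Rightarrow> 'v mfps" where
  "value2 g p q = msubst (case_sum p q) g"

definition Omega ::
  "'m::finite two_point \<Rightarrow> ('m, 'm, 'v mfps) jet \<Rightarrow> ('m, 'm, 'v mfps) jet \<Rightarrow> 'm \<Rightarrow> 'm \<Rightarrow> 'v mfps"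
  where
  "Omega \<phi> J J' \<sigma> \<rho> =
     (\<Sum>\<mu>\<in>UNIV. \<Sum>\<nu>\<in>UNIV.
        jet_jacobian J \<sigma> \<mu> * jet_jacobian J' \<rho> \<nu> * value2 (\<phi> \<mu> \<nu>) (source J) (source J'))
     - value2 (\<phi> \<sigma> \<rho>) (target J) (target J')"

text \<open>The coordinate \<open>x\<^sup>\<sigma>\<^sub>k\<close> is labelled by \<open>(\<sigma>, k)\<close>.\<close>

type_synonym 'm coord = "'m \<times> 'm multiset"

definition coordinate :: "'m coord \<Rightarrow> ('m \<Rightarrow> ('p + 'm) mfps) \<Rightarrow> 'p mfps" where
  "coordinate c X = space_coeff (snd c) (X (fst c))"

text \<open>
  The brackets \<open>{x\<^sup>\<sigma>\<^sub>k, x\<^sup>\<rho>\<^sub>l}\<close> at \<open>X\<close>, read off from \<open>{X\<^sup>\<sigma>(u), X\<^sup>\<rho>(v)} = \<Omega>\<^sup>\<sigma>\<^sup>\<rho>\<close>: the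
  coefficient of \<open>u\<^sup>k v\<^sup>l\<close> in \<open>\<Omega>\<^sup>\<sigma>\<^sup>\<rho>(j\<^sub>u X, j\<^sub>v X)\<close>.
\<close>

definition coord_bracket ::
  "'m::finite two_point \<Rightarrow> ('m \<Rightarrow> ('p + 'm) mfps) \<Rightarrow> 'm coord \<Rightarrow> 'm coord \<Rightarrow> 'p mfps" where
  "coord_bracket \<phi> X c d =
     space_coeff (image_mset Inl (snd c) + image_mset Inr (snd d))
       (Omega \<phi> (jet_at pt_u X) (jet_at pt_v X) (fst c) (fst d))"

text \<open>
  The generic formal diffeomorphism near a base point \<open>B\<close>: \<open>x\<^sup>\<sigma>\<^sub>k = b\<^sup>\<sigma>\<^sub>k + t\<^sup>\<sigma>\<^sub>k\<close>, where
  the \<open>b\<^sup>\<sigma>\<^sub>k\<close> are real numbers and the \<open>t\<^sup>\<sigma>\<^sub>k\<close> are independent variables, so that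
  \<open>\<partial>/\<partial>x\<^sup>\<sigma>\<^sub>k = \<partial>/\<partial>t\<^sup>\<sigma>\<^sub>k\<close>.
\<close>

definition generic :: "('m \<Rightarrow> 'm mfps) \<Rightarrow> 'm \<Rightarrow> ('m coord + 'm) mfps" where
  "generic B \<sigma> =
     msubst (\<lambda>\<mu>. mvar (Inr \<mu>)) (B \<sigma>)
     + Mfps (\<lambda>N. if \<exists>k. N = add_mset (Inl (\<sigma>, k)) (image_mset Inr k) then 1 else 0)"

text \<open>The biderivation with \<open>{t\<^sub>c, t\<^sub>d} = P c d\<close>.\<close>

definition bracket :: "('c \<Rightarrow> 'c \<Rightarrow> 'c mfps) \<Rightarrow> 'c mfps \<Rightarrow> 'c mfps \<Rightarrow> 'c mfps" where
  "bracket P f g = msum (\<lambda>(c, d). mderiv c f * mderiv d g * P c d)"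

definition poisson :: "('c \<Rightarrow> 'c \<Rightarrow> 'c mfps) \<Rightarrow> bool" where
  "poisson P \<longleftrightarrow>
     (\<forall>c d. P c d = - P d c) \<and>
     (\<forall>c d e. bracket P (bracket P (mvar c) (mvar d)) (mvar e)
            + bracket P (bracket P (mvar d) (mvar e)) (mvar c)
            + bracket P (bracket P (mvar e) (mvar c)) (mvar d) = 0)"

definition product_structure ::
  "('c \<Rightarrow> 'c \<Rightarrow> 'c mfps) \<Rightarrow> ('d \<Rightarrow> 'd \<Rightarrow> 'd mfps) \<Rightarrow> 'c + 'd \<Rightarrow> 'c + 'd \<Rightarrow> ('c + 'd) mfps" where
  "product_structure P Q x y =
     (case (x, y) of
        (Inl c, Inl c') \<Rightarrow> msubst (\<lambda>z. mvar (Inl z)) (P c c')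
      | (Inr d, Inr d') \<Rightarrow> msubst (\<lambda>z. mvar (Inr z)) (Q d d')
      | _ \<Rightarrow> 0)"

definition rename_params :: "('p \<Rightarrow> 'q) \<Rightarrow> ('p + 'm) mfps \<Rightarrow> ('q + 'm) mfps" where
  "rename_params r = msubst (case_sum (\<lambda>p. mvar (Inl (r p))) (\<lambda>\<mu>. mvar (Inr \<mu>)))"

text \<open>
  \<open>\<Omega>\<close> is a Poisson--Lie structure: it satisfies the Jacobi identity, and multiplication
  \<open>(X, Z) \<mapsto> X \<circ> Z\<close> is a Poisson map from the product, i.e.
  \<open>{(X \<circ> Z)\<^sup>\<sigma>(u), (X \<circ> Z)\<^sup>\<rho>(v)} = \<Omega>\<^sup>\<sigma>\<^sup>\<rho>(j\<^sub>u(X \<circ> Z), j\<^sub>v(X \<circ> Z))\<close> for independent generic \<open>X\<close> and \<open>Z\<close>.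
\<close>

definition poisson_lie :: "'m::finite two_point \<Rightarrow> bool" where
  "poisson_lie \<phi> \<longleftrightarrow>
     (\<forall>B. generic B \<in> carrier FDiff \<longrightarrow> poisson (coord_bracket \<phi> (generic B))) \<and>
     (\<forall>B C. generic B \<in> carrier FDiff \<longrightarrow> generic C \<in> carrier FDiff \<longrightarrow>
        (let X = (\<lambda>\<sigma>. rename_params Inl (generic B \<sigma>));
             Z = (\<lambda>\<sigma>. rename_params Inr (generic C \<sigma>));
             W = X \<otimes>\<^bsub>FDiff\<^esub> Z
         in \<forall>c d. bracket
                    (product_structure (coord_bracket \<phi> (generic B)) (coord_bracket \<phi> (generic C)))
                    (coordinate c W) (coordinate d W)
                  = coord_bracket \<phi> W c d))"

definition r_matrix :: "'m::finite two_point \<Rightarrow> bool" where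
  "r_matrix \<phi> \<longleftrightarrow>
     (\<forall>\<mu> \<nu>. \<phi> \<mu> \<nu> = - value2 (\<phi> \<nu> \<mu>) (\<lambda>\<kappa>. mvar (Inr \<kappa>)) (\<lambda>\<kappa>. mvar (Inl \<kappa>))) \<and>
     poisson_lie \<phi>"


section \<open>The functional equations\<close>

text \<open>
  In \<open>functional_equations\<close>, \<open>p\<close> and \<open>q\<close> are \<open>X\<^sup>-\<^sup>1(u)\<close> and \<open>X\<^sup>-\<^sup>1(v)\<close>, and \<open>a\<close> and \<open>b\<close> are
  \<open>F \<circ> X\<^sup>-\<^sup>1(u)\<close> and \<open>F \<circ> X\<^sup>-\<^sup>1(v)\<close>.
\<close>

definition functional_equations ::
  "'m::finite two_point \<Rightarrow> 'n::finite two_point \<Rightarrow>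
   (('m, 'n, ('p + ('m + 'm)) mfps) jet \<Rightarrow> ('m, 'n, ('p + ('m + 'm)) mfps) jet \<Rightarrow>
     'n \<Rightarrow> 'n \<Rightarrow> ('p + ('m + 'm)) mfps) \<Rightarrow> bool" where
  "functional_equations \<phi>m \<phi>n \<pi> \<longleftrightarrow>
     (\<forall>X \<in> carrier FDiff. \<forall>Y \<in> carrier FDiff. \<forall>F \<in> map_jets.
        let Xi = inv\<^bsub>FDiff\<^esub> X;
            G = compose F Xi;
            Fbar = compose Y G;
            p = compose Xi pt_u; q = compose Xi pt_v;
            a = compose G pt_u; b = compose G pt_v;
            Ya = jet_jacobian (jet_at a Y); Yb = jet_jacobian (jet_at b Y);
            Fp = jet_jacobian (jet_at p F); Fq = jet_jacobian (jet_at q F)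
        in \<forall>i j.
          \<pi> (jet_at pt_u Fbar) (jet_at pt_v Fbar) i j =
            (\<Sum>k\<in>UNIV. \<Sum>l\<in>UNIV. Ya i k * Yb j l * \<pi> (jet_at p F) (jet_at q F) k l)
          + (\<Sum>k\<in>UNIV. \<Sum>\<sigma>\<in>UNIV. \<Sum>l\<in>UNIV. \<Sum>\<rho>\<in>UNIV.
               Ya i k * Fp k \<sigma> * Yb j l * Fq l \<rho>
               * Omega \<phi>m (jet_at pt_u Xi) (jet_at pt_v Xi) \<sigma> \<rho>)
          + Omega \<phi>n (jet_at a Y) (jet_at b Y) i j)"

end

theory Submission
  imports Defs
begin

text \<open>
  Write \<open>Z = X\<^sup>-\<^sup>1\<close>, \<open>p = Z(u)\<close>, \<open>q = Z(v)\<close>, \<open>a = F(p)\<close>, \<open>b = F(q)\<close>.  By the chain rule the Jacobian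
  matrix of \<open>Y \<circ> F \<circ> Z\<close> at \<open>u\<close> is \<open>Y\<^sub>*\<^sub>a F\<^sub>*\<^sub>p Z\<^sub>*\<^sub>u\<close>, and its value there is \<open>Y(a)\<close>.  After this is inserted,
  both sides of the functional equation are sums of bivectors transported by these matrices.  On
  the right, \<open>\<phi>\<^sub>m(p, q)\<close>, transported by \<open>Y\<^sub>*F\<^sub>*\<close>, occurs in \<open>\<Pi>\<close> and with the opposite sign in
  \<open>\<Omega>\<^sub>m\<close>, while \<open>\<phi>\<^sub>n(a, b)\<close>, transported by \<open>Y\<^sub>*\<close>, occurs in \<open>\<Omega>\<^sub>n\<close> and with the opposite sign in \<open>\<Pi>\<close>.
  What remains is \<open>\<phi>\<^sub>m(u, v)\<close> transported by \<open>Y\<^sub>*F\<^sub>*Z\<^sub>*\<close>, minus \<open>\<phi>\<^sub>n(Y(a), Y(b))\<close>, which is the left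
  side.

  The work lies in the formal calculus.  Substitution is a ring homomorphism (\<open>msubst_mult\<close>),
  compatible with composition (\<open>msubst_msubst\<close>) and subject to the chain rule (\<open>mderiv_msubst\<close>,
  \<open>jet_jacobian_compose\<close>); as there may be infinitely many parameters, each of these rests on the
  finiteness condition \<open>substitutable\<close>.  Moreover \<open>X\<close> must have an inverse that is again a formal
  diffeomorphism (\<open>inv_FDiff_in_map_jets\<close>).  Its constant terms need not vanish but lie in the
  maximal ideal of the ring of power series in the parameters, so a right inverse is found by successive
  approximation with respect to the total degree in parameters and space variables
  (\<open>right_inverse_exists\<close>), in which the linear terms are
  corrected by the inverse of the real matrix \<open>real_linear_part X\<close>.
\<close>

section \<open>Coefficients\<close>

lemma mcoeff_add [simp]: "mcoeff (f + g) N = mcoeff f N + mcoeff g N"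
  by (simp add: plus_mfps_def)

lemma mcoeff_diff [simp]: "mcoeff (f - g) N = mcoeff f N - mcoeff g N"
  by (simp add: minus_mfps_def)

lemma mcoeff_zero [simp]: "mcoeff 0 N = 0"
  by (simp add: zero_mfps_def)

lemma mcoeff_one: "mcoeff 1 N = (if N = {#} then 1 else 0)"
  by (simp add: one_mfps_def)

lemma mcoeff_mvar: "mcoeff (mvar x) N = (if N = {#x#} then 1 else 0)"
  by (simp add: mvar_def)

lemma mcoeff_times:
  "mcoeff (f * g) N = (\<Sum>p | fst p + snd p = N. mcoeff f (fst p) * mcoeff g (snd p))"
  by (simp add: times_mfps_def case_prod_beta')

lemma finite_splits: "finite {p. fst p + snd p = (N :: 'v multiset)}"
  using finite_mset_splits [of N] by (simp add: case_prod_beta')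

lemma mcoeff_sum: "mcoeff (sum f S) N = (\<Sum>i\<in>S. mcoeff (f i) N)"
  by (induction S rule: infinite_finite_induct) auto

lemma mcoeff_times_nonzeroE:
  assumes "mcoeff (f * g) N \<noteq> 0"
  obtains A B where "N = A + B" "mcoeff f A \<noteq> 0" "mcoeff g B \<noteq> 0"
proof -
  obtain p where "p \<in> {p. fst p + snd p = N}" "mcoeff f (fst p) * mcoeff g (snd p) \<noteq> 0"
    using assms unfolding mcoeff_times by (meson sum.not_neutral_contains_not_neutral)
  then show ?thesis
    using that [of "fst p" "snd p"] by auto
qed

lemma mcoeff_times_empty [simp]: "mcoeff (f * g) {#} = mcoeff f {#} * mcoeff g {#}"
proof -
  have "{p. fst p + snd p = ({#} :: 'a multiset)} = {({#}, {#})}"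
    by auto
  then show ?thesis
    by (simp add: mcoeff_times)
qed

lemma mcoeff_times_mvar:
  "mcoeff (mvar x * f) N = (if x \<in># N then mcoeff f (N - {#x#}) else 0)"
proof -
  have *: "mcoeff (mvar x * f) N
    = (\<Sum>p \<in> (if x \<in># N then {({#x#}, N - {#x#})} else {}).
         mcoeff (mvar x) (fst p) * mcoeff f (snd p))"
    unfolding mcoeff_times
    by (rule sum.mono_neutral_right) (auto simp: finite_splits mcoeff_mvar split: if_splits)
  show ?thesis
    unfolding * by (simp add: mcoeff_mvar)
qed

lemma mcoeff_prod_mvar: "mcoeff (\<Prod>x\<in>#M. mvar x) N = (if N = M then 1 else 0)"
proof (induction M arbitrary: N)
  case empty
  then show ?case by (simp add: mcoeff_one)
next
  case (add x M)
  show ?case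
    by (auto simp: mcoeff_times_mvar add)
qed

section \<open>Substitution\<close>

text \<open>
  A family \<open>s\<close> may be substituted into an arbitrary series if every monomial occurs in only
  finitely many of the products of the members of \<open>s\<close>; the sum defining \<^const>\<open>msubst\<close> is then
  finite.
\<close>

definition substitutable :: "('v \<Rightarrow> 'w mfps) \<Rightarrow> bool" where
  "substitutable s \<longleftrightarrow> (\<forall>N. finite {M. mcoeff (\<Prod>x\<in>#M. s x) N \<noteq> 0})"

lemma mcoeff_prod_nonzeroD:
  assumes "\<And>x. mcoeff (s x) {#} = 0" and "mcoeff (\<Prod>x\<in>#M. s x) N \<noteq> 0"
  shows "size M \<le> size N \<and> set_mset M \<subseteq> {x. \<exists>K. K \<subseteq># N \<and> mcoeff (s x) K \<noteq> 0}"
  using assms(2)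
proof (induction M arbitrary: N)
  case empty
  then show ?case by simp
next
  case (add x M)
  then have "mcoeff (s x * (\<Prod>x\<in>#M. s x)) N \<noteq> 0"
    by simp
  then obtain A B where AB: "N = A + B" "mcoeff (s x) A \<noteq> 0" "mcoeff (\<Prod>x\<in>#M. s x) B \<noteq> 0"
    by (rule mcoeff_times_nonzeroE)
  have "A \<noteq> {#}"
    using AB(2) assms(1) by auto
  then have "size A > 0"
    by (simp add: nonempty_has_size)
  moreover have sub: "A \<subseteq># N" "B \<subseteq># N"
    using AB(1) by auto
  moreover have "set_mset M \<subseteq> {x. \<exists>K. K \<subseteq># N \<and> mcoeff (s x) K \<noteq> 0}"
    using add.IH [OF AB(3)] sub(2) subset_mset.order_trans by blast
  moreover have "x \<in> {x. \<exists>K. K \<subseteq># N \<and> mcoeff (s x) K \<noteq> 0}"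
    using AB(2) sub(1) by blast
  ultimately show ?case
    using add.IH [OF AB(3)] AB(1) by auto
qed

lemma substitutableI:
  assumes "\<And>x. mcoeff (s x) {#} = 0"
    and "\<And>N. finite {x. \<exists>K. K \<subseteq># N \<and> mcoeff (s x) K \<noteq> 0}"
  shows "substitutable s"
  unfolding substitutable_def
proof
  fix N
  let ?F = "{x. \<exists>K. K \<subseteq># N \<and> mcoeff (s x) K \<noteq> 0}"
  have "{M. mcoeff (\<Prod>x\<in>#M. s x) N \<noteq> 0} \<subseteq> mset ` {xs. set xs \<subseteq> ?F \<and> length xs \<le> size N}"
  proof
    fix M assume "M \<in> {M. mcoeff (\<Prod>x\<in>#M. s x) N \<noteq> 0}"
    then have "size M \<le> size N \<and> set_mset M \<subseteq> ?F"
      using mcoeff_prod_nonzeroD [where s = s, OF assms(1)] by blast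
    moreover obtain xs where "M = mset xs"
      using ex_mset by metis
    ultimately show "M \<in> mset ` {xs. set xs \<subseteq> ?F \<and> length xs \<le> size N}"
      by auto
  qed
  then show "finite {M. mcoeff (\<Prod>x\<in>#M. s x) N \<noteq> 0}"
    by (rule finite_subset) (intro finite_imageI finite_lists_length_le assms(2))
qed

lemma mcoeff_msubst:
  assumes "finite S" and "{M. mcoeff (\<Prod>x\<in>#M. s x) N \<noteq> 0} \<subseteq> S"
  shows "mcoeff (msubst s f) N = (\<Sum>M\<in>S. mcoeff f M * mcoeff (\<Prod>x\<in>#M. s x) N)"
  unfolding msubst_def mcoeff_Mfps using assms by (intro Sum_any.expand_superset) auto

lemma msubst_mvar [simp]: "msubst s (mvar x) = s x"
proof (rule mfps_eqI)
  fix N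
  have "mcoeff (msubst s (mvar x)) N
      = (\<Sum>M\<in>{{#x#}}. mcoeff (mvar x) M * mcoeff (\<Prod>x\<in>#M. s x) N)"
    unfolding msubst_def mcoeff_Mfps
    by (rule Sum_any.expand_superset) (auto simp: mcoeff_mvar split: if_splits)
  then show "mcoeff (msubst s (mvar x)) N = mcoeff (s x) N"
    by (simp add: mcoeff_mvar)
qed

lemma msubst_one [simp]: "msubst s 1 = 1"
proof (rule mfps_eqI)
  fix N
  have "mcoeff (msubst s 1) N = (\<Sum>M\<in>{{#}}. mcoeff 1 M * mcoeff (\<Prod>x\<in>#M. s x) N)"
    unfolding msubst_def mcoeff_Mfps
    by (rule Sum_any.expand_superset) (auto simp: mcoeff_one split: if_splits)
  then show "mcoeff (msubst s 1) N = mcoeff 1 N"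
    by (simp add: mcoeff_one)
qed

lemma msubst_zero [simp]: "msubst s 0 = 0"
  by (rule mfps_eqI) (simp add: msubst_def)

lemma msubst_id: "msubst mvar f = f"
proof (rule mfps_eqI)
  fix N
  have "mcoeff (msubst mvar f) N = (\<Sum>M\<in>{N}. mcoeff f M * mcoeff (\<Prod>x\<in>#M. mvar x) N)"
    by (rule mcoeff_msubst) (auto simp: mcoeff_prod_mvar)
  then show "mcoeff (msubst mvar f) N = mcoeff f N"
    by (simp add: mcoeff_prod_mvar)
qed

lemma msubst_add:
  assumes "substitutable s"
  shows "msubst s (f + g) = msubst s f + msubst s g"
proof (rule mfps_eqI)
  fix N
  have fin: "finite {M. mcoeff (\<Prod>x\<in>#M. s x) N \<noteq> 0}"
    using assms by (simp add: substitutable_def)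
  show "mcoeff (msubst s (f + g)) N = mcoeff (msubst s f + msubst s g) N"
    by (simp add: mcoeff_msubst [OF fin order_refl] sum.distrib [symmetric] algebra_simps)
qed

lemma msubst_sum:
  assumes "substitutable s"
  shows "msubst s (\<Sum>i\<in>I. f i) = (\<Sum>i\<in>I. msubst s (f i))"
  by (induction I rule: infinite_finite_induct) (auto simp: msubst_add [OF assms])

text \<open>A finite set of monomials that serves for all the divisors of \<open>N\<close> at once.\<close>

lemma substitutable_support:
  assumes "substitutable s"
  obtains T where "finite T"
    and "\<And>C. C \<subseteq># N \<Longrightarrow> {M. mcoeff (\<Prod>x\<in>#M. s x) C \<noteq> 0} \<subseteq> T"
proof
  let ?T = "\<Union>C\<in>{C. C \<subseteq># N}. {M. mcoeff (\<Prod>x\<in>#M. s x) C \<noteq> 0}"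
  show "finite ?T"
    using assms by (auto simp: substitutable_def finite_submultisets)
  show "{M. mcoeff (\<Prod>x\<in>#M. s x) C \<noteq> 0} \<subseteq> ?T" if "C \<subseteq># N" for C
    using that by auto
qed

text \<open>A product with a substituted series may be expanded term by term before the substitution.\<close>

lemma mcoeff_msubst_times:
  assumes "finite T" and "\<And>C. C \<subseteq># N \<Longrightarrow> {M. mcoeff (\<Prod>x\<in>#M. s x) C \<noteq> 0} \<subseteq> T"
  shows "mcoeff (msubst s f * h) N = (\<Sum>M\<in>T. mcoeff f M * mcoeff ((\<Prod>x\<in>#M. s x) * h) N)"
proof -
  have "mcoeff (msubst s f * h) N = (\<Sum>p | fst p + snd p = N.
      \<Sum>M\<in>T. mcoeff f M * (mcoeff (\<Prod>x\<in>#M. s x) (fst p) * mcoeff h (snd p)))"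
    unfolding mcoeff_times
  proof (rule sum.cong [OF refl])
    fix p assume "p \<in> {p. fst p + snd p = N}"
    then have "fst p \<subseteq># N" by auto
    then have "{M. mcoeff (\<Prod>x\<in>#M. s x) (fst p) \<noteq> 0} \<subseteq> T"
      by (rule assms(2))
    then show "mcoeff (msubst s f) (fst p) * mcoeff h (snd p)
        = (\<Sum>M\<in>T. mcoeff f M * (mcoeff (\<Prod>x\<in>#M. s x) (fst p) * mcoeff h (snd p)))"
      by (simp add: mcoeff_msubst [OF assms(1)] sum_distrib_right mult.assoc)
  qed
  also have "\<dots> = (\<Sum>M\<in>T. mcoeff f M * mcoeff ((\<Prod>x\<in>#M. s x) * h) N)"
    by (subst sum.swap) (simp add: mcoeff_times sum_distrib_left)
  finally show ?thesis .
qed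

lemma msubst_mult:
  assumes "substitutable s"
  shows "msubst s (f * g) = msubst s f * msubst s g"
proof (rule mfps_eqI)
  fix N
  let ?P = "\<lambda>M. \<Prod>x\<in>#M. s x"
  obtain T where T: "finite T" "\<And>C. C \<subseteq># N \<Longrightarrow> {M. mcoeff (?P M) C \<noteq> 0} \<subseteq> T"
    using substitutable_support [OF assms] by metis
  let ?h = "\<lambda>p. mcoeff f (fst p) * mcoeff g (snd p) * mcoeff (?P (fst p) * ?P (snd p)) N"
  let ?S = "{M. mcoeff (?P M) N \<noteq> 0}"
  have finS: "finite ?S"
    using assms by (simp add: substitutable_def)
  have "mcoeff (msubst s f * msubst s g) N
      = (\<Sum>A\<in>T. mcoeff f A * mcoeff (msubst s g * ?P A) N)"
    by (subst mcoeff_msubst_times [OF T]) (simp_all add: mult.commute)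
  also have "\<dots> = (\<Sum>A\<in>T. \<Sum>B\<in>T. ?h (A, B))"
    by (subst mcoeff_msubst_times [OF T]) (simp_all add: sum_distrib_left mult_ac)
  also have "\<dots> = sum ?h (T \<times> T)"
    by (simp add: sum.cartesian_product case_prod_beta)
  also have "\<dots> = sum ?h (\<Union>M\<in>?S. {p. fst p + snd p = M})"
  proof (rule sum.mono_neutral_cong)
    show "?h p = 0" if "p \<in> T \<times> T - (\<Union>M\<in>?S. {p. fst p + snd p = M})" for p
      using that by auto
    show "?h p = 0" if p: "p \<in> (\<Union>M\<in>?S. {p. fst p + snd p = M}) - T \<times> T" for p
    proof (rule ccontr)
      assume "?h p \<noteq> 0"
      then have "mcoeff (?P (fst p) * ?P (snd p)) N \<noteq> 0"
        by simp
      then obtain C D where "N = C + D" "mcoeff (?P (fst p)) C \<noteq> 0" "mcoeff (?P (snd p)) D \<noteq> 0"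
        by (rule mcoeff_times_nonzeroE)
      then have "fst p \<in> T" "snd p \<in> T"
        using T(2) [of C] T(2) [of D] by auto
      with p show False
        by (auto simp: mem_Times_iff)
    qed
  qed (use T(1) finS finite_splits in auto)
  also have "\<dots> = (\<Sum>M\<in>?S. \<Sum>p | fst p + snd p = M. ?h p)"
    using finS finite_splits by (intro sum.UNION_disjoint) auto
  also have "\<dots> = (\<Sum>M\<in>?S. mcoeff (f * g) M * mcoeff (?P M) N)"
    by (intro sum.cong refl) (auto simp: mcoeff_times sum_distrib_right intro!: sum.cong)
  also have "\<dots> = mcoeff (msubst s (f * g)) N"
    using finS by (subst mcoeff_msubst) auto
  finally show "mcoeff (msubst s (f * g)) N = mcoeff (msubst s f * msubst s g) N"
    by simp
qed


lemma msubst_prod_mset: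
  assumes "substitutable s"
  shows "msubst s (\<Prod>x\<in>#M. r x) = (\<Prod>x\<in>#M. msubst s (r x))"
  by (induction M) (simp_all add: msubst_mult [OF assms])

lemma msubst_msubst:
  assumes "substitutable s" "substitutable r"
  shows "msubst s (msubst r f) = msubst (\<lambda>x. msubst s (r x)) f"
proof (rule mfps_eqI)
  fix N
  let ?S = "{M. mcoeff (\<Prod>x\<in>#M. s x) N \<noteq> 0}"
  let ?R = "\<Union>M\<in>?S. {K. mcoeff (\<Prod>x\<in>#K. r x) M \<noteq> 0}"
  have finS: "finite ?S"
    using assms(1) by (simp add: substitutable_def)
  then have finR: "finite ?R"
    using assms(2) by (simp add: substitutable_def)
  have prod: "mcoeff (\<Prod>x\<in>#K. msubst s (r x)) N
      = (\<Sum>M\<in>?S. mcoeff (\<Prod>x\<in>#K. r x) M * mcoeff (\<Prod>x\<in>#M. s x) N)" for K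
    by (simp add: msubst_prod_mset [OF assms(1), symmetric] mcoeff_msubst [OF finS order_refl])
  have "mcoeff (msubst s (msubst r f)) N
      = (\<Sum>M\<in>?S. mcoeff (msubst r f) M * mcoeff (\<Prod>x\<in>#M. s x) N)"
    by (rule mcoeff_msubst [OF finS order_refl])
  also have "\<dots> = (\<Sum>M\<in>?S. \<Sum>K\<in>?R.
      mcoeff f K * mcoeff (\<Prod>x\<in>#K. r x) M * mcoeff (\<Prod>x\<in>#M. s x) N)"
  proof (rule sum.cong [OF refl])
    fix M assume "M \<in> ?S"
    then have "{K. mcoeff (\<Prod>x\<in>#K. r x) M \<noteq> 0} \<subseteq> ?R"
      by blast
    from mcoeff_msubst [OF finR this]
    show "mcoeff (msubst r f) M * mcoeff (\<Prod>x\<in>#M. s x) N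
      = (\<Sum>K\<in>?R. mcoeff f K * mcoeff (\<Prod>x\<in>#K. r x) M * mcoeff (\<Prod>x\<in>#M. s x) N)"
      by (simp add: sum_distrib_right)
  qed
  also have "\<dots> = (\<Sum>K\<in>?R. mcoeff f K * mcoeff (\<Prod>x\<in>#K. msubst s (r x)) N)"
    by (subst sum.swap) (simp add: prod sum_distrib_left mult.assoc)
  also have "\<dots> = mcoeff (msubst (\<lambda>x. msubst s (r x)) f) N"
  proof (rule mcoeff_msubst [OF finR, symmetric], rule subsetI, rule ccontr)
    fix K assume "K \<in> {K. mcoeff (\<Prod>x\<in>#K. msubst s (r x)) N \<noteq> 0}" "K \<notin> ?R"
    moreover from this(2) have "mcoeff (\<Prod>x\<in>#K. r x) M = 0" if "M \<in> ?S" for M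
      using that by blast
    ultimately show False
      by (simp add: prod)
  qed
  finally show "mcoeff (msubst s (msubst r f)) N = mcoeff (msubst (\<lambda>x. msubst s (r x)) f) N" .
qed

lemma mcoeff_msubst_empty:
  assumes "\<And>x. mcoeff (s x) {#} = 0"
  shows "mcoeff (msubst s f) {#} = mcoeff f {#}"
proof -
  have "{M. mcoeff (\<Prod>x\<in>#M. s x) {#} \<noteq> 0} \<subseteq> {{#}}"
    using mcoeff_prod_nonzeroD [where s = s, OF assms] by fastforce
  then have "mcoeff (msubst s f) {#} = (\<Sum>M\<in>{{#}}. mcoeff f M * mcoeff (\<Prod>x\<in>#M. s x) {#})"
    by (rule mcoeff_msubst [rotated]) simp
  then show ?thesis
    by (simp add: mcoeff_one)
qed


section \<open>Partial derivatives\<close>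

lemma mcoeff_mderiv: "mcoeff (mderiv x f) N = real (count N x + 1) * mcoeff f (add_mset x N)"
  by (simp add: mderiv_def)

lemma mcoeff_mderiv_empty [simp]: "mcoeff (mderiv x f) {#} = mcoeff f {#x#}"
  by (simp add: mcoeff_mderiv)

lemma mderiv_mvar: "mderiv x (mvar y) = (if x = y then 1 else 0)"
  by (rule mfps_eqI) (auto simp: mcoeff_mderiv mcoeff_mvar mcoeff_one)

lemma mderiv_one [simp]: "mderiv x 1 = 0"
  by (rule mfps_eqI) (auto simp: mcoeff_mderiv mcoeff_one)

lemma mderiv_commute: "mderiv x (mderiv y f) = mderiv y (mderiv x f)"
  by (rule mfps_eqI) (auto simp: mcoeff_mderiv add_mset_commute)

lemma mderiv_mult: "mderiv x (f * g) = mderiv x f * g + f * mderiv x g"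
proof (rule mfps_eqI)
  fix N
  let ?S = "\<lambda>N :: 'a multiset. {p. fst p + snd p = N}"
  have *: "mcoeff (mderiv x f * g) N
      = (\<Sum>p\<in>?S (add_mset x N). real (count (fst p) x) * (mcoeff f (fst p) * mcoeff g (snd p)))"
    for f g
  proof -
    let ?t = "\<lambda>p :: 'a multiset \<times> 'a multiset. (add_mset x (fst p), snd p)"
    let ?h = "\<lambda>p. real (count (fst p) x) * (mcoeff f (fst p) * mcoeff g (snd p))"
    have "mcoeff (mderiv x f * g) N = sum (?h \<circ> ?t) (?S N)"
      by (simp add: mcoeff_times mcoeff_mderiv mult.assoc)
    also have "\<dots> = sum ?h (?t ` ?S N)"
      by (rule sum.reindex [symmetric]) (auto simp: inj_on_def prod_eq_iff)
    also have "\<dots> = sum ?h (?S (add_mset x N))"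
    proof (rule sum.mono_neutral_left)
      show "\<forall>p\<in>?S (add_mset x N) - ?t ` ?S N. ?h p = 0"
      proof
        fix p assume p: "p \<in> ?S (add_mset x N) - ?t ` ?S N"
        have "x \<notin># fst p"
        proof
          assume "x \<in># fst p"
          then obtain A where "fst p = add_mset x A"
            by (meson multi_member_split)
          with p have "p = ?t (A, snd p)" "(A, snd p) \<in> ?S N"
            by (auto simp: prod_eq_iff)
          with p show False by blast
        qed
        then show "?h p = 0"
          by (simp add: not_in_iff)
      qed
    qed (auto simp: finite_splits)
    finally show ?thesis .
  qed
  have flip: "(\<Sum>p\<in>?S M. h (fst p) (snd p)) = (\<Sum>p\<in>?S M. h (snd p) (fst p))"
    for M and h :: "'a multiset \<Rightarrow> 'a multiset \<Rightarrow> real"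
    by (rule sum.reindex_bij_witness [where i = prod.swap and j = prod.swap])
       (auto simp: add.commute)
  have **: "mcoeff (f * mderiv x g) N
      = (\<Sum>p\<in>?S (add_mset x N). real (count (snd p) x) * (mcoeff f (fst p) * mcoeff g (snd p)))"
    using * [of g f] flip [of "\<lambda>A B. real (count A x) * (mcoeff g A * mcoeff f B)" "add_mset x N"]
    by (simp add: mult.commute)
  have "mcoeff (mderiv x (f * g)) N
    = (\<Sum>p\<in>?S (add_mset x N). real (count N x + 1) * (mcoeff f (fst p) * mcoeff g (snd p)))"
    by (simp only: mcoeff_mderiv mcoeff_times sum_distrib_left)
  also have "\<dots> = (\<Sum>p\<in>?S (add_mset x N).
       real (count (fst p) x) * (mcoeff f (fst p) * mcoeff g (snd p))
       + real (count (snd p) x) * (mcoeff f (fst p) * mcoeff g (snd p)))"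
  proof (rule sum.cong [OF refl])
    fix p assume "p \<in> ?S (add_mset x N)"
    then have "count (fst p + snd p) x = count (add_mset x N) x"
      by simp
    then have "real (count N x + 1) = real (count (fst p) x) + real (count (snd p) x)"
      by simp
    then show "real (count N x + 1) * (mcoeff f (fst p) * mcoeff g (snd p))
      = real (count (fst p) x) * (mcoeff f (fst p) * mcoeff g (snd p))
       + real (count (snd p) x) * (mcoeff f (fst p) * mcoeff g (snd p))"
      by (simp only: distrib_right)
  qed
  also have "\<dots> = mcoeff (mderiv x f * g + f * mderiv x g) N"
    by (simp only: sum.distrib mcoeff_add * **)
  finally show "mcoeff (mderiv x (f * g)) N = mcoeff (mderiv x f * g + f * mderiv x g) N" .
qed

lemma mcoeff_of_nat_times [simp]: "mcoeff (of_nat n * f) N = real n * mcoeff f N"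
  by (induction n) (simp_all add: algebra_simps)

lemma mderiv_prod_mset:
  assumes "finite F" "\<And>y. y \<notin> F \<Longrightarrow> mderiv z (s y) = 0"
  shows "mderiv z (\<Prod>x\<in>#M. s x)
    = (\<Sum>y\<in>F. of_nat (count M y) * ((\<Prod>x\<in>#M - {#y#}. s x) * mderiv z (s y)))"
proof (induction M)
  case empty
  then show ?case by simp
next
  case (add x M)
  let ?P = "\<lambda>M. \<Prod>x\<in>#M. s x"
  have step: "of_nat (count (add_mset x M) y) * (?P (add_mset x M - {#y#}) * mderiv z (s y))
      = (if y = x then ?P M * mderiv z (s x) else 0)
        + s x * (of_nat (count M y) * (?P (M - {#y#}) * mderiv z (s y)))" for y
  proof (cases "y \<in># M")
    case True
    then obtain K where "M = add_mset y K"
      by (meson multi_member_split)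
    then show ?thesis
      by (simp add: algebra_simps add_mset_commute)
  next
    case False
    then show ?thesis
      by (cases "y = x") (auto simp: not_in_iff)
  qed
  have "(\<Sum>y\<in>F. if y = x then ?P M * mderiv z (s x) else 0) = mderiv z (s x) * ?P M"
    using assms by (cases "x \<in> F") (simp_all add: mult.commute)
  then show ?case
    by (simp only: step sum.distrib) (simp add: mderiv_mult add sum_distrib_left)
qed

text \<open>
  The chain rule.  Only finitely many of the substituted series may depend on the variable \<open>z\<close>, so
  that the sum over the inner variables is finite.
\<close>

lemma mderiv_msubst:
  assumes s: "substitutable s" and F: "finite F" "\<And>y. y \<notin> F \<Longrightarrow> mderiv z (s y) = 0"
  shows "mderiv z (msubst s f) = (\<Sum>y\<in>F. msubst s (mderiv y f) * mderiv z (s y))"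
proof (rule mfps_eqI)
  fix N
  let ?P = "\<lambda>M. \<Prod>x\<in>#M. s x"
  obtain T where T: "finite T" "\<And>C. C \<subseteq># add_mset z N \<Longrightarrow> {M. mcoeff (?P M) C \<noteq> 0} \<subseteq> T"
    using substitutable_support [OF s] by metis
  have sub: "C \<subseteq># add_mset z N" if "C \<subseteq># N" for C
    using that by (metis add_mset_add_single mset_subset_eq_add_left subset_mset.order_trans)
  let ?T = "T \<union> (\<Union>y\<in>F. add_mset y ` T)"
  let ?h = "\<lambda>y M. real (count M y) * (mcoeff f M * mcoeff (?P (M - {#y#}) * mderiv z (s y)) N)"
  have "mcoeff (mderiv z (msubst s f)) N
      = (\<Sum>M\<in>?T. mcoeff f M * mcoeff (mderiv z (?P M)) N)"
    unfolding mcoeff_mderiv using T F(1)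
    by (subst mcoeff_msubst [where S = ?T]) (auto simp: sum_distrib_left mult_ac)
  also have "\<dots> = (\<Sum>M\<in>?T. \<Sum>y\<in>F. ?h y M)"
    by (simp add: mderiv_prod_mset [where s = s and z = z and F = F, OF F] mcoeff_sum
        sum_distrib_left mult.left_commute)
  also have "\<dots> = (\<Sum>y\<in>F. sum (?h y) ?T)"
    by (rule sum.swap)
  also have "\<dots> = (\<Sum>y\<in>F. mcoeff (msubst s (mderiv y f) * mderiv z (s y)) N)"
  proof (rule sum.cong [OF refl])
    fix y assume y: "y \<in> F"
    have "sum (?h y) ?T = sum (?h y) (add_mset y ` T)"
    proof (rule sum.mono_neutral_right)
      show "\<forall>M\<in>?T - add_mset y ` T. ?h y M = 0"
      proof (rule ballI, rule ccontr)
        fix M assume M: "M \<in> ?T - add_mset y ` T" and nz: "?h y M \<noteq> 0"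
        from nz have "y \<in># M"
          by (auto simp: not_in_iff)
        then obtain K where K: "M = add_mset y K"
          by (meson multi_member_split)
        with nz have "mcoeff (?P K * mderiv z (s y)) N \<noteq> 0"
          by simp
        then obtain A B where "N = A + B" "mcoeff (?P K) A \<noteq> 0"
          by (rule mcoeff_times_nonzeroE)
        then have "K \<in> T"
          using T(2) [OF sub, of A] by auto
        with M K show False
          by simp
      qed
    qed (use T(1) F(1) y in auto)
    also have "\<dots> = sum (?h y \<circ> add_mset y) T"
      by (rule sum.reindex) (simp add: inj_on_def)
    also have "\<dots> = mcoeff (msubst s (mderiv y f) * mderiv z (s y)) N"
      using T sub by (subst mcoeff_msubst_times [where T = T]) (auto simp: mcoeff_mderiv mult_ac)
    finally show "sum (?h y) ?T = mcoeff (msubst s (mderiv y f) * mderiv z (s y)) N" .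
  qed
  finally show "mcoeff (mderiv z (msubst s f)) N
      = mcoeff (\<Sum>y\<in>F. msubst s (mderiv y f) * mderiv z (s y)) N"
    by (simp add: mcoeff_sum)
qed


section \<open>Composition and jets\<close>

text \<open>
  The substitution that defines \<^const>\<open>value_at\<close>: the point \<open>q\<close> for the space variables, each
  parameter for itself.
\<close>

abbreviation point_subst :: "('s \<Rightarrow> ('p + 'w) mfps) \<Rightarrow> 'p + 's \<Rightarrow> ('p + 'w) mfps" where
  "point_subst q \<equiv> case_sum (\<lambda>p. mvar (Inl p)) q"

lemma map_jetsI: "(\<And>i. mcoeff (F i) {#} = 0) \<Longrightarrow> F \<in> map_jets"
  by (simp add: map_jets_def)

lemma map_jetsD: "F \<in> map_jets \<Longrightarrow> mcoeff (F i) {#} = 0"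
  by (simp add: map_jets_def)

lemma mcoeff_point_subst_empty: "q \<in> map_jets \<Longrightarrow> mcoeff (point_subst q x) {#} = 0"
  by (cases x) (simp_all add: mcoeff_mvar map_jets_def)

lemma substitutable_point_subst:
  fixes q :: "'s::finite \<Rightarrow> ('p + 'w) mfps"
  assumes "q \<in> map_jets"
  shows "substitutable (point_subst q)"
proof (rule substitutableI)
  fix N :: "('p + 'w) multiset"
  have "finite (Inl -` set_mset N :: 'p set)"
    by (intro finite_vimageI) auto
  moreover have "{x. \<exists>K. K \<subseteq># N \<and> mcoeff (point_subst q x) K \<noteq> 0}
      \<subseteq> Inl ` (Inl -` set_mset N) \<union> range Inr"
  proof
    fix x assume "x \<in> {x. \<exists>K. K \<subseteq># N \<and> mcoeff (point_subst q x) K \<noteq> 0}"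
    then obtain K where "K \<subseteq># N" "mcoeff (point_subst q x) K \<noteq> 0"
      by blast
    then show "x \<in> Inl ` (Inl -` set_mset N) \<union> range Inr"
      by (cases x) (auto simp: mcoeff_mvar split: if_splits)
  qed
  ultimately show "finite {x. \<exists>K. K \<subseteq># N \<and> mcoeff (point_subst q x) K \<noteq> 0}"
    by (meson finite_UnI finite_imageI finite_subset finite)
qed (rule mcoeff_point_subst_empty [OF assms])

lemma mcoeff_value_at_empty [simp]: "q \<in> map_jets \<Longrightarrow> mcoeff (value_at f q) {#} = mcoeff f {#}"
  unfolding value_at_def by (rule mcoeff_msubst_empty [OF mcoeff_point_subst_empty])

lemma compose_in_map_jets: "G \<in> map_jets \<Longrightarrow> H \<in> map_jets \<Longrightarrow> compose G H \<in> map_jets"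
  by (rule map_jetsI) (simp add: compose_def map_jetsD)

lemma value_at_value_at:
  fixes H :: "'t::finite \<Rightarrow> ('p + 's::finite) mfps"
  assumes "H \<in> map_jets" "q \<in> map_jets"
  shows "value_at (value_at f H) q = value_at f (compose H q)"
proof -
  have "(\<lambda>x. msubst (point_subst q) (point_subst H x)) = point_subst (compose H q)"
    by (auto simp: fun_eq_iff compose_def value_at_def split: sum.splits)
  then show ?thesis
    unfolding value_at_def
    by (simp add: msubst_msubst [OF substitutable_point_subst substitutable_point_subst] assms)
qed

lemma compose_assoc:
  fixes H :: "'t::finite \<Rightarrow> ('p + 's::finite) mfps"
  assumes "H \<in> map_jets" "q \<in> map_jets"
  shows "compose (compose G H) q = compose G (compose H q)"
  using value_at_value_at [OF assms] by (simp add: compose_def [of G] compose_def [of _ q])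

lemma compose_id_left: "compose (\<lambda>i. mvar (Inr i)) q = q"
  by (simp add: compose_def value_at_def)

lemma value_at_id [simp]:
  fixes g :: "('p + 's) mfps"
  shows "value_at g (\<lambda>i. mvar (Inr i)) = g"
proof -
  have "point_subst (\<lambda>i :: 's. mvar (Inr i)) = (mvar :: _ \<Rightarrow> ('p + 's) mfps)"
    by (auto simp: fun_eq_iff split: sum.splits)
  then show ?thesis
    by (simp add: value_at_def msubst_id)
qed

lemma compose_id_right: "compose G (\<lambda>i. mvar (Inr i)) = G"
  by (simp add: compose_def)

lemma mderiv_value_at:
  fixes q :: "'s::finite \<Rightarrow> ('p + 'w) mfps"
  assumes "q \<in> map_jets"
  shows "mderiv (Inr \<mu>) (value_at f q)
    = (\<Sum>k\<in>UNIV. value_at (mderiv (Inr k) f) q * mderiv (Inr \<mu>) (q k))"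
proof -
  have "mderiv (Inr \<mu>) (point_subst q y) = 0" if "y \<notin> range Inr" for y
    using that by (cases y) (auto simp: mderiv_mvar)
  then have "mderiv (Inr \<mu>) (value_at f q)
      = (\<Sum>y\<in>range Inr. msubst (point_subst q) (mderiv y f) * mderiv (Inr \<mu>) (point_subst q y))"
    unfolding value_at_def
    by (intro mderiv_msubst substitutable_point_subst assms) auto
  also have "\<dots> = (\<Sum>k\<in>UNIV. value_at (mderiv (Inr k) f) q * mderiv (Inr \<mu>) (q k))"
    by (subst sum.reindex) (auto simp: value_at_def)
  finally show ?thesis .
qed

lemma mderivs_empty [simp]: "mderivs {#} f = f"
  by (simp add: mderivs_def)

lemma mderivs_single [simp]: "mderivs {#x#} f = mderiv x f"
proof -
  interpret comp_fun_commute mderiv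
    by standard (auto simp: mderiv_commute)
  show ?thesis
    by (simp add: mderivs_def)
qed

lemma source_jet_at [simp]: "source (jet_at q G) = q"
  by (simp add: jet_at_def)

lemma target_jet_at [simp]: "target (jet_at q G) = compose G q"
  by (simp add: target_def jet_at_def compose_def fun_eq_iff)

lemma jet_jacobian_jet_at: "jet_jacobian (jet_at q G) i \<mu> = value_at (mderiv (Inr \<mu>) (G i)) q"
  by (simp add: jet_jacobian_def jet_at_def)

text \<open>\<open>(G \<circ> H)\<^sub>*\<^sub>q = G\<^sub>*\<^sub>H\<^sub>(\<^sub>q\<^sub>) H\<^sub>*\<^sub>q\<close>.\<close>

lemma jet_jacobian_compose:
  fixes H :: "'t::finite \<Rightarrow> ('p + 's::finite) mfps"
  assumes "H \<in> map_jets" "q \<in> map_jets"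
  shows "jet_jacobian (jet_at q (compose G H)) i \<mu>
    = (\<Sum>k\<in>UNIV. jet_jacobian (jet_at (compose H q) G) i k * jet_jacobian (jet_at q H) k \<mu>)"
proof -
  have "jet_jacobian (jet_at q (compose G H)) i \<mu>
      = value_at (\<Sum>k\<in>UNIV. value_at (mderiv (Inr k) (G i)) H * mderiv (Inr \<mu>) (H k)) q"
    unfolding jet_jacobian_jet_at by (simp add: compose_def mderiv_value_at assms)
  also have "\<dots> = (\<Sum>k\<in>UNIV. value_at (value_at (mderiv (Inr k) (G i)) H) q
      * value_at (mderiv (Inr \<mu>) (H k)) q)"
    unfolding value_at_def [where q = q]
    by (simp add: msubst_sum msubst_mult substitutable_point_subst assms)
  finally show ?thesis
    by (simp add: jet_jacobian_jet_at value_at_value_at assms)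
qed


section \<open>Inverses of formal diffeomorphisms\<close>

lemma mcoeff_times_cong:
  assumes "\<And>N. size N < d \<Longrightarrow> mcoeff f N = mcoeff f' N"
    and "\<And>N. size N < d \<Longrightarrow> mcoeff g N = mcoeff g' N"
    and "size N < d"
  shows "mcoeff (f * g) N = mcoeff (f' * g') N"
  unfolding mcoeff_times using assms by (intro sum.cong refl arg_cong2 [where f = times]) auto

text \<open>
  If the factors have no constant terms, their agreement in total degree less than \<open>d\<close> carries
  over to the product even in degree \<open>d\<close>.
\<close>

lemma mcoeff_times_cong_Suc:
  assumes "\<And>N. size N < d \<Longrightarrow> mcoeff f N = mcoeff f' N"
    and "\<And>N. size N < d \<Longrightarrow> mcoeff g N = mcoeff g' N"
    and "mcoeff f {#} = 0" "mcoeff f' {#} = 0" "mcoeff g {#} = 0" "mcoeff g' {#} = 0"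
    and "size N \<le> d"
  shows "mcoeff (f * g) N = mcoeff (f' * g') N"
  unfolding mcoeff_times
proof (rule sum.cong [OF refl])
  fix p assume "p \<in> {p. fst p + snd p = N}"
  then have p: "size (fst p) + size (snd p) \<le> d"
    using assms(7) by auto
  show "mcoeff f (fst p) * mcoeff g (snd p) = mcoeff f' (fst p) * mcoeff g' (snd p)"
  proof (cases "fst p = {#} \<or> snd p = {#}")
    case True
    then show ?thesis
      using assms(3-6) by auto
  next
    case False
    then have "size (fst p) > 0" "size (snd p) > 0"
      by (auto simp: nonempty_has_size)
    then show ?thesis
      using p assms(1) [of "fst p"] assms(2) [of "snd p"] by simp
  qed
qed

lemma mcoeff_prod_mset_cong:
  assumes "\<And>x N. size N < d \<Longrightarrow> mcoeff (s x) N = mcoeff (s' x) N" "size N < d"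
  shows "mcoeff (\<Prod>x\<in>#M. s x) N = mcoeff (\<Prod>x\<in>#M. s' x) N"
  using assms(2)
proof (induction M arbitrary: N)
  case (add x M)
  then show ?case
    using assms(1) by (auto intro: mcoeff_times_cong)
qed simp

lemma mcoeff_prod_mset_cong_Suc:
  assumes s: "\<And>x N. size N < d \<Longrightarrow> mcoeff (s x) N = mcoeff (s' x) N"
    and s0: "\<And>x. mcoeff (s x) {#} = 0" "\<And>x. mcoeff (s' x) {#} = 0"
    and "size N \<le> d" "size M \<ge> 2"
  shows "mcoeff (\<Prod>x\<in>#M. s x) N = mcoeff (\<Prod>x\<in>#M. s' x) N"
proof -
  obtain x K where M: "M = add_mset x K"
    using assms(5) by (cases M) auto
  then obtain y L where "K = add_mset y L"
    using assms(5) by (cases K) auto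
  then have "mcoeff (\<Prod>x\<in>#K. s x) {#} = 0" "mcoeff (\<Prod>x\<in>#K. s' x) {#} = 0"
    using s0 by simp_all
  then have "mcoeff (s x * (\<Prod>x\<in>#K. s x)) N = mcoeff (s' x * (\<Prod>x\<in>#K. s' x)) N"
    using assms by (intro mcoeff_times_cong_Suc [where d = d] mcoeff_prod_mset_cong) auto
  then show ?thesis
    by (simp add: M)
qed

text \<open>
  If \<open>Z\<close> and \<open>Z'\<close> agree in total degree less than \<open>d\<close>, then in degree at most \<open>d\<close> the difference of
  \<open>f(Z)\<close> and \<open>f(Z')\<close> comes only from the terms of \<open>f\<close> that are linear in the space variables and
  free of the parameters.
\<close>

lemma mcoeff_value_at_diff:
  fixes Z Z' :: "'s::finite \<Rightarrow> ('p + 'w) mfps"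
  assumes Z: "Z \<in> map_jets" "Z' \<in> map_jets"
    and agree: "\<And>\<mu> N. size N < d \<Longrightarrow> mcoeff (Z \<mu>) N = mcoeff (Z' \<mu>) N"
    and N: "size N \<le> d"
  shows "mcoeff (value_at f Z) N - mcoeff (value_at f Z') N
    = (\<Sum>\<kappa>\<in>UNIV. mcoeff f {#Inr \<kappa>#} * (mcoeff (Z \<kappa>) N - mcoeff (Z' \<kappa>) N))"
proof -
  let ?P = "\<lambda>Z M. \<Prod>x\<in>#M. point_subst Z x"
  let ?L = "range (\<lambda>\<kappa>. {#Inr \<kappa>#}) :: ('p + 's) multiset set"
  let ?S = "{M. mcoeff (?P Z M) N \<noteq> 0} \<union> {M. mcoeff (?P Z' M) N \<noteq> 0} \<union> ?L"
  let ?h = "\<lambda>M. mcoeff f M * (mcoeff (?P Z M) N - mcoeff (?P Z' M) N)"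
  have fin: "finite ?S"
    using substitutable_point_subst [OF Z(1)] substitutable_point_subst [OF Z(2)]
    by (auto simp: substitutable_def)
  have "mcoeff (value_at f Z) N - mcoeff (value_at f Z') N = sum ?h ?S"
    unfolding value_at_def
    by (subst (1 2) mcoeff_msubst [OF fin]) (auto simp: sum_subtractf algebra_simps)
  also have "\<dots> = sum ?h ?L"
  proof (rule sum.mono_neutral_right [OF fin])
    show "\<forall>M\<in>?S - ?L. ?h M = 0"
    proof
      fix M assume M: "M \<in> ?S - ?L"
      consider "M = {#}" | x where "M = {#x#}" | "size M \<ge> 2"
        by (metis One_nat_def Suc_leI le_neq_implies_less nonempty_has_size one_add_one
            plus_1_eq_Suc size_1_singleton_mset)
      then show "?h M = 0"
      proof cases
        case 2
        with M obtain p where "x = Inl p"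
          by (cases x) auto
        with 2 show ?thesis by simp
      next
        case 3
        have "mcoeff (point_subst Z x) K = mcoeff (point_subst Z' x) K" if "size K < d" for x K
          using agree [OF that] by (cases x) simp_all
        then have "mcoeff (?P Z M) N = mcoeff (?P Z' M) N"
          using 3 N Z by (intro mcoeff_prod_mset_cong_Suc [where d = d] mcoeff_point_subst_empty)
        then show ?thesis by simp
      qed simp
    qed
  qed auto
  also have "\<dots> = (\<Sum>\<kappa>\<in>UNIV. mcoeff f {#Inr \<kappa>#} * (mcoeff (Z \<kappa>) N - mcoeff (Z' \<kappa>) N))"
    by (subst sum.reindex) (auto simp: inj_on_def)
  finally show ?thesis .
qed

text \<open>The linear part at the origin of the parameters, a real matrix.\<close>

definition real_linear_part :: "('m::finite \<Rightarrow> ('p + 'm) mfps) \<Rightarrow> real ^ 'm ^ 'm" where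
  "real_linear_part X = (\<chi> \<mu> \<nu>. mcoeff (X \<mu>) {#Inr \<nu>#})"

text \<open>
  A right inverse is a fixed point of the Newton-like map \<open>Z \<mapsto> Z - B (X \<circ> Z - id)\<close>, where \<open>B\<close> is the
  inverse of the real linear part of \<open>X\<close>.  This map is a contraction for the total degree in the
  parameters and the space variables.
\<close>

lemma right_inverse_exists:
  fixes X :: "'m::finite \<Rightarrow> ('p + 'm) mfps"
  assumes X: "X \<in> map_jets" and inv: "invertible (real_linear_part X)"
  obtains Z where "Z \<in> map_jets" "compose X Z = (\<lambda>\<mu>. mvar (Inr \<mu>))"
proof -
  define L where "L = real_linear_part X"
  obtain B where B: "L ** B = mat 1" "B ** L = mat 1"
    using inv by (auto simp: invertible_def L_def)
  define E :: "('m \<Rightarrow> ('p + 'm) mfps) \<Rightarrow> 'm \<Rightarrow> ('p + 'm) mfps"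
    where "E Z \<nu> = value_at (X \<nu>) Z - mvar (Inr \<nu>)" for Z \<nu>
  define T :: "('m \<Rightarrow> ('p + 'm) mfps) \<Rightarrow> 'm \<Rightarrow> ('p + 'm) mfps"
    where "T Z \<mu> = Mfps (\<lambda>N. mcoeff (Z \<mu>) N - (\<Sum>\<nu>\<in>UNIV. B $ \<mu> $ \<nu> * mcoeff (E Z \<nu>) N))" for Z \<mu>
  have T_jets: "T Z \<in> map_jets" if "Z \<in> map_jets" for Z
    by (rule map_jetsI) (simp add: T_def E_def mcoeff_mvar map_jetsD that X)
  have contract: "mcoeff (T Z \<mu>) N = mcoeff (T Z' \<mu>) N"
    if Z: "Z \<in> map_jets" "Z' \<in> map_jets"
      and agree: "\<And>\<mu> N. size N < d \<Longrightarrow> mcoeff (Z \<mu>) N = mcoeff (Z' \<mu>) N"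
      and N: "size N \<le> d" for Z Z' d \<mu> N
  proof -
    let ?D = "\<lambda>\<kappa>. mcoeff (Z \<kappa>) N - mcoeff (Z' \<kappa>) N"
    have "mcoeff (E Z \<nu>) N - mcoeff (E Z' \<nu>) N = (\<Sum>\<kappa>\<in>UNIV. L $ \<nu> $ \<kappa> * ?D \<kappa>)" for \<nu>
      using mcoeff_value_at_diff [OF Z agree N, of "X \<nu>"]
      by (simp add: E_def L_def real_linear_part_def)
    then have "(\<Sum>\<nu>\<in>UNIV. B $ \<mu> $ \<nu> * (mcoeff (E Z \<nu>) N - mcoeff (E Z' \<nu>) N))
        = (\<Sum>\<nu>\<in>UNIV. \<Sum>\<kappa>\<in>UNIV. B $ \<mu> $ \<nu> * L $ \<nu> $ \<kappa> * ?D \<kappa>)"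
      by (simp add: sum_distrib_left mult.assoc)
    also have "\<dots> = (\<Sum>\<kappa>\<in>UNIV. (B ** L) $ \<mu> $ \<kappa> * ?D \<kappa>)"
      by (subst sum.swap) (simp add: matrix_matrix_mult_def sum_distrib_right)
    also have "\<dots> = ?D \<mu>"
      by (simp add: B mat_def if_distrib if_distribR cong: if_cong)
    finally show ?thesis
      by (simp add: T_def right_diff_distrib sum_subtractf)
  qed
  \<comment> \<open>The iterate \<open>Zs k\<close> is correct in degree at most \<open>k\<close>, so the limit takes each coefficient from
    the iterate numbered by its degree.\<close>
  define Zs where "Zs k = (T ^^ k) (\<lambda>_. 0)" for k
  have Zs_Suc: "Zs (Suc k) = T (Zs k)" for k
    by (simp add: Zs_def)
  have Zs_jets: "Zs k \<in> map_jets" for k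
    by (induction k) (simp_all add: Zs_Suc T_jets, simp add: Zs_def map_jets_def)
  have Zs_step: "mcoeff (Zs (Suc k) \<mu>) N = mcoeff (Zs k \<mu>) N" if "size N \<le> k" for k \<mu> N
    using that
  proof (induction k arbitrary: \<mu> N)
    case 0
    then show ?case
      using Zs_jets by (simp add: map_jets_def)
  next
    case (Suc k)
    show ?case
      unfolding Zs_Suc [of "Suc k"] Zs_Suc [of k]
      using Suc Zs_jets by (intro contract [where d = "Suc k"]) (auto simp: Zs_Suc [symmetric])
  qed
  have Zs_stable: "mcoeff (Zs k \<mu>) N = mcoeff (Zs (size N) \<mu>) N" if "size N \<le> k" for k \<mu> N
    using that by (induction k rule: dec_induct) (simp_all add: Zs_step)
  define Z where "Z \<mu> = Mfps (\<lambda>N. mcoeff (Zs (size N) \<mu>) N)" for \<mu>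
  have Z_Zs: "mcoeff (Z \<mu>) N = mcoeff (Zs k \<mu>) N" if "size N \<le> k" for k \<mu> N
    using Zs_stable [OF that] by (simp add: Z_def)
  have Z: "Z \<in> map_jets"
    using Zs_jets by (simp add: map_jets_def Z_def)
  have fixed: "mcoeff (T Z \<mu>) N = mcoeff (Z \<mu>) N" for \<mu> N
  proof -
    have "mcoeff (T Z \<mu>) N = mcoeff (T (Zs (size N)) \<mu>) N"
      by (rule contract [where d = "size N"]) (auto simp: Z Zs_jets Z_Zs)
    also have "\<dots> = mcoeff (Z \<mu>) N"
      by (simp add: Zs_Suc [symmetric] Z_Zs [of N "Suc (size N)"])
    finally show ?thesis .
  qed
  have "mcoeff (E Z \<kappa>) N = 0" for \<kappa> N
  proof -
    have BE: "(\<Sum>\<nu>\<in>UNIV. B $ \<mu> $ \<nu> * mcoeff (E Z \<nu>) N) = 0" for \<mu>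
      using fixed [of \<mu> N] by (simp add: T_def)
    have "mcoeff (E Z \<kappa>) N = (\<Sum>\<nu>\<in>UNIV. (L ** B) $ \<kappa> $ \<nu> * mcoeff (E Z \<nu>) N)"
      by (simp add: B mat_def if_distrib if_distribR cong: if_cong)
    also have "\<dots> = (\<Sum>\<mu>\<in>UNIV. L $ \<kappa> $ \<mu> * (\<Sum>\<nu>\<in>UNIV. B $ \<mu> $ \<nu> * mcoeff (E Z \<nu>) N))"
      unfolding sum_distrib_left
      by (subst sum.swap) (simp add: matrix_matrix_mult_def sum_distrib_right mult.assoc)
    also have "\<dots> = 0"
      by (simp add: BE)
    finally show ?thesis .
  qed
  then have "E Z \<kappa> = 0" for \<kappa>
    by (simp add: mfps_eqI)
  then have "compose X Z = (\<lambda>\<mu>. mvar (Inr \<mu>))"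
    by (simp add: E_def compose_def fun_eq_iff)
  with Z show ?thesis
    using that by blast
qed


lemma real_linear_part_compose:
  fixes X Z :: "'m::finite \<Rightarrow> ('p + 'm) mfps"
  assumes "Z \<in> map_jets"
  shows "real_linear_part (compose X Z) = real_linear_part X ** real_linear_part Z"
proof -
  have "mcoeff (value_at f Z) {#Inr \<nu>#}
      = (\<Sum>\<kappa>\<in>UNIV. mcoeff f {#Inr \<kappa>#} * mcoeff (Z \<kappa>) {#Inr \<nu>#})" for f \<nu>
  proof -
    have "mcoeff (value_at f Z) {#Inr \<nu>#} = mcoeff (mderiv (Inr \<nu>) (value_at f Z)) {#}"
      by simp
    then show ?thesis
      unfolding mderiv_value_at [OF assms] by (simp add: mcoeff_sum assms)
  qed
  then show ?thesis
    by (simp add: real_linear_part_def matrix_matrix_mult_def compose_def vec_eq_iff)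
qed

lemma real_linear_part_id: "real_linear_part (\<lambda>\<mu>. mvar (Inr \<mu>)) = mat 1"
  by (auto simp: real_linear_part_def mat_def mcoeff_mvar vec_eq_iff)

text \<open>
  A right inverse \<open>Z\<close> of \<open>X\<close> has an invertible real linear part, hence a right inverse \<open>W\<close> of its own,
  and \<open>W = (X \<circ> Z) \<circ> W = X\<close>.
\<close>

lemma inverse_exists:
  fixes X :: "'m::finite \<Rightarrow> ('p + 'm) mfps"
  assumes X: "X \<in> map_jets" "invertible (real_linear_part X)"
  obtains Z where "Z \<in> map_jets" "compose X Z = (\<lambda>\<mu>. mvar (Inr \<mu>))"
    "compose Z X = (\<lambda>\<mu>. mvar (Inr \<mu>))"
proof -
  obtain Z where Z: "Z \<in> map_jets" "compose X Z = (\<lambda>\<mu>. mvar (Inr \<mu>))"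
    using right_inverse_exists [OF X] by blast
  have "real_linear_part X ** real_linear_part Z = mat 1"
    using real_linear_part_compose [OF Z(1), of X] Z(2) by (simp add: real_linear_part_id)
  then have "invertible (real_linear_part Z)"
    using invertible_left_inverse by blast
  then obtain W where W: "W \<in> map_jets" "compose Z W = (\<lambda>\<mu>. mvar (Inr \<mu>))"
    using right_inverse_exists [OF Z(1)] by blast
  have "W = compose (compose X Z) W"
    by (simp add: Z(2) compose_id_left)
  also have "\<dots> = X"
    by (simp add: compose_assoc Z(1) W compose_id_right)
  finally show ?thesis
    using that Z W(2) by blast
qed

text \<open>Setting the space variables to zero is multiplicative.\<close>

lemma space_coeff_empty_times:
  "space_coeff {#} (f * g) = space_coeff {#} f * space_coeff {#} (g :: ('p + 'm) mfps)"
proof (rule mfps_eqI)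
  fix M :: "'p multiset"
  let ?i = "image_mset (Inl :: 'p \<Rightarrow> 'p + 'm)"
  have inj: "inj ?i"
    by (simp add: multiset.inj_map)
  have "{p. fst p + snd p = ?i M} = map_prod ?i ?i ` {p. fst p + snd p = M}"
  proof (intro equalityI subsetI)
    fix p assume "p \<in> {p. fst p + snd p = ?i M}"
    then have "?i M = fst p + snd p" by simp
    then obtain A B where "M = A + B" "fst p = ?i A" "snd p = ?i B"
      by (metis image_mset_eq_plusD)
    then show "p \<in> map_prod ?i ?i ` {p. fst p + snd p = M}"
      by (intro image_eqI [where x = "(A, B)"]) (auto simp: prod_eq_iff)
  qed auto
  moreover have "inj_on (map_prod ?i ?i) {p. fst p + snd p = M}"
    using inj by (auto simp: inj_on_def prod_eq_iff)
  ultimately show "mcoeff (space_coeff {#} (f * g)) M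
      = mcoeff (space_coeff {#} f * space_coeff {#} g) M"
    by (simp add: space_coeff_def mcoeff_times sum.reindex)
qed

lemma space_coeff_sum: "space_coeff K (sum f I) = (\<Sum>i\<in>I. space_coeff K (f i))"
  by (rule mfps_eqI) (simp add: space_coeff_def mcoeff_sum)

lemma space_coeff_delta:
  "space_coeff {#} (if P then 1 else 0) = (if P then 1 else 0)"
  by (rule mfps_eqI) (auto simp: space_coeff_def mcoeff_one)

lemma linear_part_eq_mderiv:
  fixes Z :: "'m::finite \<Rightarrow> ('p + 'm) mfps"
  shows "linear_part Z $ \<mu> $ \<nu> = space_coeff {#} (mderiv (Inr \<nu>) (Z \<mu>))"
proof (rule mfps_eqI)
  fix M :: "'p multiset"
  have "count (image_mset Inl M) (Inr \<nu>) = 0"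
    by (auto simp: count_eq_zero_iff)
  then show "mcoeff (linear_part Z $ \<mu> $ \<nu>) M = mcoeff (space_coeff {#} (mderiv (Inr \<nu>) (Z \<mu>))) M"
    by (simp add: linear_part_def space_coeff_def mcoeff_mderiv)
qed

text \<open>
  By the chain rule the Jacobian matrices of \<open>Z\<close>, and of \<open>X\<close> at \<open>Z\<close>, are inverse to each other; the
  linear part of \<open>Z\<close> is the Jacobian matrix of \<open>Z\<close> at the origin of the space variables.
\<close>

lemma invertible_linear_part:
  fixes X Z :: "'m::finite \<Rightarrow> ('p + 'm) mfps"
  assumes jets: "X \<in> map_jets" "Z \<in> map_jets"
    and inv: "compose X Z = (\<lambda>\<mu>. mvar (Inr \<mu>))" "compose Z X = (\<lambda>\<mu>. mvar (Inr \<mu>))"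
  shows "invertible (linear_part Z)"
proof -
  let ?id = "\<lambda>\<mu> :: 'm. mvar (Inr \<mu>) :: ('p + 'm) mfps"
  define P where "P i k = jet_jacobian (jet_at Z X) i k" for i k
  define Q where "Q i k = mderiv (Inr k) (Z i)" for i k
  have id: "?id \<in> map_jets"
    by (simp add: map_jets_def mcoeff_mvar)
  have Q: "jet_jacobian (jet_at ?id Z) i k = Q i k" for i k
    by (simp add: jet_jacobian_jet_at Q_def)
  have delta: "jet_jacobian (jet_at q ?id) i k = (if i = k then 1 else 0)"
    for q :: "'m \<Rightarrow> ('p + 'm) mfps" and i k
    by (auto simp: jet_jacobian_jet_at mderiv_mvar value_at_def)
  have PQ: "(\<Sum>k\<in>UNIV. P i k * Q k \<mu>) = (if i = \<mu> then 1 else 0)" for i \<mu>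
    using jet_jacobian_compose [OF jets(2) id, of X i \<mu>]
    by (simp add: inv compose_id_right delta Q P_def)
  have QP: "(\<Sum>k\<in>UNIV. Q i k * P k \<mu>) = (if i = \<mu> then 1 else 0)" for i \<mu>
    using jet_jacobian_compose [OF jets, of Z i \<mu>]
    by (simp add: inv delta Q P_def)
  let ?P = "(\<chi> i k. space_coeff {#} (P i k)) :: 'p mfps ^ 'm ^ 'm"
  have "linear_part Z ** ?P = mat 1"
    by (simp add: vec_eq_iff matrix_matrix_mult_def mat_def linear_part_eq_mderiv Q_def [symmetric]
        space_coeff_empty_times [symmetric] space_coeff_sum [symmetric] QP space_coeff_delta)
  moreover have "?P ** linear_part Z = mat 1"
    by (simp add: vec_eq_iff matrix_matrix_mult_def mat_def linear_part_eq_mderiv Q_def [symmetric]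
        space_coeff_empty_times [symmetric] space_coeff_sum [symmetric] PQ space_coeff_delta)
  ultimately show ?thesis
    by (auto simp: invertible_def)
qed

text \<open>Taking constant terms is a homomorphism from the power series in the parameters to the reals.\<close>

lemma invertible_real_linear_part:
  fixes X :: "'m::finite \<Rightarrow> ('p + 'm) mfps"
  assumes "invertible (linear_part X)"
  shows "invertible (real_linear_part X)"
proof -
  define c :: "'p mfps ^ 'm ^ 'm \<Rightarrow> real ^ 'm ^ 'm"
    where "c A = (\<chi> i j. mcoeff (A $ i $ j) {#})" for A
  have mult: "c (A ** A') = c A ** c A'" for A A'
    by (simp add: c_def matrix_matrix_mult_def vec_eq_iff mcoeff_sum)
  have one: "c (mat 1) = mat 1"
    by (simp add: c_def mat_def vec_eq_iff mcoeff_one)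
  have "c (linear_part X) = real_linear_part X"
    by (simp add: c_def linear_part_def real_linear_part_def space_coeff_def vec_eq_iff)
  with assms mult one show ?thesis
    unfolding invertible_def by metis
qed

lemma inv_FDiff_in_map_jets:
  fixes X :: "'m::finite \<Rightarrow> ('p + 'm) mfps"
  assumes "X \<in> carrier FDiff"
  shows "inv\<^bsub>FDiff\<^esub> X \<in> map_jets"
proof -
  have X: "X \<in> map_jets" "invertible (real_linear_part X)"
    using assms invertible_real_linear_part by (auto simp: FDiff_def)
  obtain Z where Z: "Z \<in> map_jets" "compose X Z = (\<lambda>\<mu>. mvar (Inr \<mu>))"
    "compose Z X = (\<lambda>\<mu>. mvar (Inr \<mu>))"
    using inverse_exists [OF X] by blast
  have "inv\<^bsub>FDiff\<^esub> X = Z"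
    unfolding m_inv_def
  proof (rule the_equality)
    show "Z \<in> carrier FDiff \<and> X \<otimes>\<^bsub>FDiff\<^esub> Z = \<one>\<^bsub>FDiff\<^esub> \<and> Z \<otimes>\<^bsub>FDiff\<^esub> X = \<one>\<^bsub>FDiff\<^esub>"
      using Z invertible_linear_part [OF X(1) Z(1)] by (simp add: FDiff_def)
  next
    fix W assume "W \<in> carrier FDiff \<and> X \<otimes>\<^bsub>FDiff\<^esub> W = \<one>\<^bsub>FDiff\<^esub> \<and> W \<otimes>\<^bsub>FDiff\<^esub> X = \<one>\<^bsub>FDiff\<^esub>"
    then have "compose W X = (\<lambda>\<mu>. mvar (Inr \<mu>))"
      by (simp add: FDiff_def)
    then have "Z = compose (compose W X) Z"
      by (simp add: compose_id_left)
    also have "\<dots> = W"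
      by (simp add: compose_assoc X Z compose_id_right)
    finally show "W = Z" ..
  qed
  with Z show ?thesis by simp
qed


section \<open>The coboundary solution\<close>

lemma sum_swap2:
  "(\<Sum>a\<in>A. \<Sum>b\<in>B. \<Sum>c\<in>C. \<Sum>d\<in>D. t a b c d)
    = (\<Sum>c\<in>C. \<Sum>d\<in>D. \<Sum>a\<in>A. \<Sum>b\<in>B. t a b c d :: 'a::comm_monoid_add)"
proof -
  have "(\<Sum>a\<in>A. \<Sum>b\<in>B. \<Sum>c\<in>C. \<Sum>d\<in>D. t a b c d) = (\<Sum>a\<in>A. \<Sum>c\<in>C. \<Sum>b\<in>B. \<Sum>d\<in>D. t a b c d)"
    by (intro sum.cong refl sum.swap)
  also have "\<dots> = (\<Sum>c\<in>C. \<Sum>a\<in>A. \<Sum>b\<in>B. \<Sum>d\<in>D. t a b c d)"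
    by (rule sum.swap)
  also have "\<dots> = (\<Sum>c\<in>C. \<Sum>a\<in>A. \<Sum>d\<in>D. \<Sum>b\<in>B. t a b c d)"
    by (intro sum.cong refl sum.swap)
  also have "\<dots> = (\<Sum>c\<in>C. \<Sum>d\<in>D. \<Sum>a\<in>A. \<Sum>b\<in>B. t a b c d)"
    by (intro sum.cong refl sum.swap)
  finally show ?thesis .
qed

text \<open>Transforming a bivector by a product of two matrices is transforming it twice.\<close>

lemma transform_bivector_mult:
  fixes c :: "'i \<Rightarrow> 'i \<Rightarrow> 'a::comm_ring"
  shows "(\<Sum>\<mu>\<in>I. \<Sum>\<nu>\<in>I. (\<Sum>\<sigma>\<in>J. g \<sigma> * x \<sigma> \<mu>) * (\<Sum>\<rho>\<in>J. h \<rho> * y \<rho> \<nu>) * c \<mu> \<nu>)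
    = (\<Sum>\<sigma>\<in>J. \<Sum>\<rho>\<in>J. g \<sigma> * h \<rho> * (\<Sum>\<mu>\<in>I. \<Sum>\<nu>\<in>I. x \<sigma> \<mu> * y \<rho> \<nu> * c \<mu> \<nu>))"
proof -
  have "(\<Sum>\<mu>\<in>I. \<Sum>\<nu>\<in>I. (\<Sum>\<sigma>\<in>J. g \<sigma> * x \<sigma> \<mu>) * (\<Sum>\<rho>\<in>J. h \<rho> * y \<rho> \<nu>) * c \<mu> \<nu>)
      = (\<Sum>\<mu>\<in>I. \<Sum>\<nu>\<in>I. \<Sum>\<sigma>\<in>J. \<Sum>\<rho>\<in>J. g \<sigma> * h \<rho> * (x \<sigma> \<mu> * y \<rho> \<nu> * c \<mu> \<nu>))"
    unfolding sum_product unfolding sum_distrib_right by (intro sum.cong refl) (simp only: mult_ac)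
  also have "\<dots> = (\<Sum>\<sigma>\<in>J. \<Sum>\<rho>\<in>J. \<Sum>\<mu>\<in>I. \<Sum>\<nu>\<in>I. g \<sigma> * h \<rho> * (x \<sigma> \<mu> * y \<rho> \<nu> * c \<mu> \<nu>))"
    by (rule sum_swap2)
  finally show ?thesis
    by (simp add: sum_distrib_left)
qed

theorem proposition5p2:
  fixes \<phi>m :: "'m::finite two_point" and \<phi>n :: "'n::finite two_point"
  assumes "r_matrix \<phi>m" and "r_matrix \<phi>n"
  shows "functional_equations \<phi>m \<phi>n
    (\<lambda>(J :: ('m, 'n, ('p + ('m + 'm)) mfps) jet) J' i j.
      (\<Sum>\<mu>\<in>UNIV. \<Sum>\<nu>\<in>UNIV.
         jet_jacobian J i \<mu> * jet_jacobian J' j \<nu> * value2 (\<phi>m \<mu> \<nu>) (source J) (source J'))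
      - value2 (\<phi>n i j) (target J) (target J'))"
  unfolding functional_equations_def Let_def
proof (intro ballI allI, goal_cases)
  case (1 X Y F i j)
  then have X: "X \<in> carrier FDiff" and F: "F \<in> map_jets"
    by simp_all
  define Xi where "Xi = inv\<^bsub>FDiff\<^esub> X"
  have Xi: "Xi \<in> map_jets"
    unfolding Xi_def by (rule inv_FDiff_in_map_jets [OF X])
  define u :: "'m \<Rightarrow> ('p + ('m + 'm)) mfps" where "u = pt_u"
  define v :: "'m \<Rightarrow> ('p + ('m + 'm)) mfps" where "v = pt_v"
  have u: "u \<in> map_jets" and v: "v \<in> map_jets"
    by (simp_all add: u_def v_def pt_u_def pt_v_def map_jets_def mcoeff_mvar)
  define p where "p = compose Xi u"
  define q where "q = compose Xi v"
  have p: "p \<in> map_jets" and q: "q \<in> map_jets"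
    by (simp_all add: p_def q_def compose_in_map_jets Xi u v)
  define a where "a = compose F p"
  define b where "b = compose F q"
  have G: "compose F Xi \<in> map_jets"
    by (simp add: compose_in_map_jets F Xi)
  have a': "compose (compose F Xi) u = a" and b': "compose (compose F Xi) v = b"
    by (simp_all add: a_def b_def p_def q_def compose_assoc Xi u v)
  have Ya': "compose (compose Y (compose F Xi)) u = compose Y a"
    and Yb': "compose (compose Y (compose F Xi)) v = compose Y b"
    by (simp_all add: compose_assoc G u v a' b')
  define Ya where "Ya = jet_jacobian (jet_at a Y)"
  define Yb where "Yb = jet_jacobian (jet_at b Y)"
  define Fp where "Fp = jet_jacobian (jet_at p F)"
  define Fq where "Fq = jet_jacobian (jet_at q F)"
  define Xu where "Xu = jet_jacobian (jet_at u Xi)"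
  define Xv where "Xv = jet_jacobian (jet_at v Xi)"
  have JGu: "jet_jacobian (jet_at u (compose F Xi)) k \<mu> = (\<Sum>\<sigma>\<in>UNIV. Fp k \<sigma> * Xu \<sigma> \<mu>)" for k \<mu>
    by (simp add: jet_jacobian_compose Xi u p_def Fp_def Xu_def)
  have JGv: "jet_jacobian (jet_at v (compose F Xi)) l \<nu> = (\<Sum>\<rho>\<in>UNIV. Fq l \<rho> * Xv \<rho> \<nu>)" for l \<nu>
    by (simp add: jet_jacobian_compose Xi v q_def Fq_def Xv_def)
  have Ju: "jet_jacobian (jet_at u (compose Y (compose F Xi))) i \<mu>
      = (\<Sum>k\<in>UNIV. Ya i k * (\<Sum>\<sigma>\<in>UNIV. Fp k \<sigma> * Xu \<sigma> \<mu>))" for i \<mu>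
    by (simp add: jet_jacobian_compose [of "compose F Xi"] G u a' Ya_def JGu)
  have Jv: "jet_jacobian (jet_at v (compose Y (compose F Xi))) j \<nu>
      = (\<Sum>l\<in>UNIV. Yb j l * (\<Sum>\<rho>\<in>UNIV. Fq l \<rho> * Xv \<rho> \<nu>))" for j \<nu>
    by (simp add: jet_jacobian_compose [of "compose F Xi"] G v b' Yb_def JGv)
  define C where "C \<mu> \<nu> = value2 (\<phi>m \<mu> \<nu>) u v" for \<mu> \<nu>
  define D where "D \<sigma> \<rho> = value2 (\<phi>m \<sigma> \<rho>) p q" for \<sigma> \<rho>
  define E where "E k l = value2 (\<phi>n k l) a b" for k l
  define V where "V = value2 (\<phi>n i j) (compose Y a) (compose Y b)"
  define R where "R \<sigma> \<rho> = (\<Sum>\<mu>\<in>UNIV. \<Sum>\<nu>\<in>UNIV. Xu \<sigma> \<mu> * Xv \<rho> \<nu> * C \<mu> \<nu>)" for \<sigma> \<rho>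
  have left: "(\<Sum>\<mu>\<in>UNIV. \<Sum>\<nu>\<in>UNIV.
        (\<Sum>k\<in>UNIV. Ya i k * (\<Sum>\<sigma>\<in>UNIV. Fp k \<sigma> * Xu \<sigma> \<mu>))
        * (\<Sum>l\<in>UNIV. Yb j l * (\<Sum>\<rho>\<in>UNIV. Fq l \<rho> * Xv \<rho> \<nu>)) * C \<mu> \<nu>)
      = (\<Sum>k\<in>UNIV. \<Sum>l\<in>UNIV. Ya i k * Yb j l
          * (\<Sum>\<sigma>\<in>UNIV. \<Sum>\<rho>\<in>UNIV. Fp k \<sigma> * Fq l \<rho> * R \<sigma> \<rho>))"
    unfolding transform_bivector_mult R_def ..
  have middle: "(\<Sum>k\<in>UNIV. \<Sum>\<sigma>\<in>UNIV. \<Sum>l\<in>UNIV. \<Sum>\<rho>\<in>UNIV.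
        Ya i k * Fp k \<sigma> * Yb j l * Fq l \<rho> * (R \<sigma> \<rho> - D \<sigma> \<rho>))
      = (\<Sum>k\<in>UNIV. \<Sum>l\<in>UNIV. Ya i k * Yb j l
          * (\<Sum>\<sigma>\<in>UNIV. \<Sum>\<rho>\<in>UNIV. Fp k \<sigma> * Fq l \<rho> * (R \<sigma> \<rho> - D \<sigma> \<rho>)))"
    unfolding sum_distrib_left
    by (intro sum.cong refl, subst sum.swap) (simp add: mult_ac)
  \<comment> \<open>On the right-hand side the terms in \<open>D = \<phi>\<^sub>m(p, q)\<close> and in \<open>E = \<phi>\<^sub>n(a, b)\<close> cancel.\<close>
  have "(\<Sum>k\<in>UNIV. \<Sum>l\<in>UNIV. Ya i k * Yb j l
          * (\<Sum>\<sigma>\<in>UNIV. \<Sum>\<rho>\<in>UNIV. Fp k \<sigma> * Fq l \<rho> * R \<sigma> \<rho>)) - V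
      = (\<Sum>k\<in>UNIV. \<Sum>l\<in>UNIV. Ya i k * Yb j l
          * ((\<Sum>\<sigma>\<in>UNIV. \<Sum>\<rho>\<in>UNIV. Fp k \<sigma> * Fq l \<rho> * D \<sigma> \<rho>) - E k l))
      + (\<Sum>k\<in>UNIV. \<Sum>l\<in>UNIV. Ya i k * Yb j l
          * (\<Sum>\<sigma>\<in>UNIV. \<Sum>\<rho>\<in>UNIV. Fp k \<sigma> * Fq l \<rho> * (R \<sigma> \<rho> - D \<sigma> \<rho>)))
      + ((\<Sum>k\<in>UNIV. \<Sum>l\<in>UNIV. Ya i k * Yb j l * E k l) - V)"
    by (simp add: right_diff_distrib sum_subtractf)
  then show ?case
    unfolding Omega_def Xi_def [symmetric] u_def [symmetric] v_def [symmetric]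
      source_jet_at target_jet_at a' b' Ya' Yb' p_def [symmetric] q_def [symmetric] a_def [symmetric] b_def [symmetric]
      Ju Jv Ya_def [symmetric] Yb_def [symmetric] Fp_def [symmetric] Fq_def [symmetric]
      Xu_def [symmetric] Xv_def [symmetric] C_def [symmetric] D_def [symmetric] E_def [symmetric]
      V_def [symmetric] R_def [symmetric] left middle .
qed

end
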